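(* Let $\alpha_1,\alpha_2>-1$ and $\alpha>-\min(1,1+\alpha_1,1+\alpha_2)$. For the Jacobi $\beta$-ensemble with $\beta=2\alpha/N$, let $m^{\rm J}_{p,0}$ be the limiting moments and $\mu^{\rm J}_{(p,q),0}$ the limiting scaled covariances of monomial linear statistics (see context). Then for all integers $p,q\ge1$, $$\mu_{(p,q),0}^{\rm J}=\frac{1}{p+\alpha_1+\alpha_2+2\alpha+1}\Big(q\,(m_{q,0}^{\rm J}-m_{p+q,0}^{\rm J})-\alpha_2\sum_{s=1}^{p-1}\mu_{(s,q),0}^{\rm J}-2\alpha\sum_{s=1}^{p-1}m_{s,0}^{\rm J}\,\mu_{(p-s,q),0}^{\rm J}\Big).$$
   Context: The Jacobi $\beta$-ensemble is the probability density on $(0,1)^N$ proportional to $\prod_{l=1}^N\lambda_l^{\alpha_1}(1-\lambda_l)^{\alpha_2}\prod_{1\le j<k\le N}|\lambda_k-\lambda_j|^\beta$. Here $\beta=2\alpha/N$ with $\alpha,\alpha_1,\alpha_2$ fixed, and $N\to\infty$. Standing assumption (large-$N$ ansatz): for every $n\ge1$ and all integers $p_1,\dots,p_n\ge0$, the joint cumulant of $\sum_j\lambda_j^{p_1},\dots,\sum_j\lambda_j^{p_n}$ (with $\beta=2\alpha/N$) has, as $N\to\infty$, an asymptotic expansion $N\sum_{l\ge0}c^{(l)}_{p_1,\dots,p_n}N^{-l}$ with coefficients independent of $N$. $m^{\rm J}_{p,0}=\lim_{N\to\infty}\frac1N\big\langle\sum_{j=1}^N\lambda_j^p\big\rangle$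 and $\mu^{\rm J}_{(p,q),0}=\lim_{N\to\infty}\frac1N{\rm Cov}\big(\sum_i\lambda_i^p,\sum_i\lambda_i^q\big)$. Empty sums are zero. *)

theory Defs
  imports "HOL-Probability.Probability" "HOL-Library.Landau_Symbols" "HOL-Library.Disjoint_Sets"
begin

text \<open>
  The Jacobi \<open>\<beta>\<close>-ensemble with \<open>N\<close> particles, as a measure on functions \<open>nat \<Rightarrow> real\<close> supported on
  the index set \<open>{..<N}\<close>. Since \<open>0 powr b = 0\<close> for every \<open>b\<close>, the weight vanishes at
  configurations with coinciding particles, also for \<open>\<beta> \<le> 0\<close>; these form a null set.
\<close>

definition jacobi_weight :: "nat \<Rightarrow> real \<Rightarrow> real \<Rightarrow> real \<Rightarrow> (nat \<Rightarrow> real) \<Rightarrow> real" where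
  "jacobi_weight N \<alpha>1 \<alpha>2 \<beta> x =
     indicator (PiE {..<N} (\<lambda>_. {0<..<1})) x *
     (\<Prod>l<N. x l powr \<alpha>1 * (1 - x l) powr \<alpha>2) *
     (\<Prod>k<N. \<Prod>j<k. \<bar>x k - x j\<bar> powr \<beta>)"

definition jacobi_partition_function :: "nat \<Rightarrow> real \<Rightarrow> real \<Rightarrow> real \<Rightarrow> real" where
  "jacobi_partition_function N \<alpha>1 \<alpha>2 \<beta> =
     (\<integral>x. jacobi_weight N \<alpha>1 \<alpha>2 \<beta> x \<partial>PiM {..<N} (\<lambda>_. lborel))"

definition jacobi_ensemble :: "nat \<Rightarrow> real \<Rightarrow> real \<Rightarrow> real \<Rightarrow> (nat \<Rightarrow> real) measure" where
  "jacobi_ensemble N \<alpha>1 \<alpha>2 \<beta> =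
     density (PiM {..<N} (\<lambda>_. lborel))
       (\<lambda>x. ennreal (jacobi_weight N \<alpha>1 \<alpha>2 \<beta> x / jacobi_partition_function N \<alpha>1 \<alpha>2 \<beta>))"

definition covariance :: "'a measure \<Rightarrow> ('a \<Rightarrow> real) \<Rightarrow> ('a \<Rightarrow> real) \<Rightarrow> real" where
  "covariance M X Y =
     (\<integral>\<omega>. (X \<omega> - (\<integral>\<omega>'. X \<omega>' \<partial>M)) * (Y \<omega> - (\<integral>\<omega>'. Y \<omega>' \<partial>M)) \<partial>M)"

text \<open>The joint cumulant of the finite family \<open>X i\<close>, \<open>i \<in> I\<close>, by the moment-cumulant formula.\<close>

definition joint_cumulant :: "'a measure \<Rightarrow> 'i set \<Rightarrow> ('i \<Rightarrow> 'a \<Rightarrow> real) \<Rightarrow> real" where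
  "joint_cumulant M I X =
     (\<Sum>P | partition_on I P.
        (-1) ^ (card P - 1) * fact (card P - 1) * (\<Prod>B\<in>P. \<integral>\<omega>. (\<Prod>i\<in>B. X i \<omega>) \<partial>M))"

definition power_stat :: "nat \<Rightarrow> nat \<Rightarrow> (nat \<Rightarrow> real) \<Rightarrow> real" where
  "power_stat N p x = (\<Sum>j<N. x j ^ p)"

definition jacobi_high_temp :: "real \<Rightarrow> real \<Rightarrow> real \<Rightarrow> nat \<Rightarrow> (nat \<Rightarrow> real) measure" where
  "jacobi_high_temp \<alpha>1 \<alpha>2 \<alpha> N = jacobi_ensemble N \<alpha>1 \<alpha>2 (2 * \<alpha> / real N)"

text \<open>
  \<open>f N\<close> has the (Poincare) asymptotic expansion \<open>N * (\<Sum>l. c l * N ^ (-l))\<close> as \<open>N \<rightarrow> \<infinity>\<close>;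
  the series need not converge.
\<close>

definition has_large_N_expansion :: "(nat \<Rightarrow> real) \<Rightarrow> (nat \<Rightarrow> real) \<Rightarrow> bool" where
  "has_large_N_expansion f c \<longleftrightarrow>
     (\<forall>L. (\<lambda>N. f N - real N * (\<Sum>l\<le>L. c l / real N ^ l)) \<in> o(\<lambda>N. real N / real N ^ L))"

definition jacobi_large_N_ansatz :: "real \<Rightarrow> real \<Rightarrow> real \<Rightarrow> bool" where
  "jacobi_large_N_ansatz \<alpha>1 \<alpha>2 \<alpha> \<longleftrightarrow>
     (\<forall>n\<ge>1. \<forall>p :: nat \<Rightarrow> nat. \<exists>c. has_large_N_expansion
        (\<lambda>N. joint_cumulant (jacobi_high_temp \<alpha>1 \<alpha>2 \<alpha> N) {1..n} (\<lambda>i. power_stat N (p i))) c)"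

text \<open>
  Both limits exist under \<open>jacobi_large_N_ansatz\<close>: they are the leading coefficients
  \<open>c 0\<close> for \<open>n = 1\<close> and \<open>n = 2\<close>.
\<close>

definition jacobi_moment_lim :: "real \<Rightarrow> real \<Rightarrow> real \<Rightarrow> nat \<Rightarrow> real" where
  "jacobi_moment_lim \<alpha>1 \<alpha>2 \<alpha> p =
     lim (\<lambda>N. 1 / real N * (\<integral>x. power_stat N p x \<partial>jacobi_high_temp \<alpha>1 \<alpha>2 \<alpha> N))"

definition jacobi_cov_lim :: "real \<Rightarrow> real \<Rightarrow> real \<Rightarrow> nat \<Rightarrow> nat \<Rightarrow> real" where
  "jacobi_cov_lim \<alpha>1 \<alpha>2 \<alpha> p q =
     lim (\<lambda>N. 1 / real N *
       covariance (jacobi_high_temp \<alpha>1 \<alpha>2 \<alpha> N) (power_stat N p) (power_stat N q))"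

end

theory Submission
  imports Defs
begin

text \<open>
  Moving every particle by the flow \<open>x \<mapsto> x + t (x - x\<^sup>p\<^sup>+\<^sup>1)\<close>, which fixes \<open>0\<close> and \<open>1\<close>, does not change
  the integral of \<open>x\<^sub>j\<^sup>q\<close> against the unnormalised weight, and for small \<open>t\<close> it multiplies the
  weight by a bounded factor that is smooth in \<open>t\<close>. Hence the invariance can be differentiated at
  \<open>t = 0\<close> by dominated convergence, whatever the sign of \<open>\<beta>\<close> and without estimates on the singular
  weight. The derivative is the loop equation of the ensemble, summed over the powers \<open>1, \<dots>, p\<close>. It
  expresses covariances of products of two power sums, and splitting these into cumulants and dividing
  by \<open>N\<close> gives the recurrence, because third cumulants are \<open>O(N)\<close> and enter with a factor
  \<open>\<beta> = O(1/N)\<close>.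
\<close>

section \<open>Differentiating under a change of variables\<close>

text \<open>Induction on the coordinates with Tonelli: the new coordinate is integrated first, the
  one-dimensional substitution is applied to the section of \<open>F\<close> over the already moved
  remaining coordinates, and the induction hypothesis handles the resulting \<open>G\<close>. The
  integrands are nonnegative, so no integrability is at stake.\<close>

lemma (in product_sigma_finite) nn_integral_PiM_substitution:
  assumes "finite I"
    and [measurable]: "\<And>i. w i \<in> borel_measurable (M i)" "\<And>i. u i \<in> borel_measurable (M i)"
      "\<And>i. \<phi> i \<in> measurable (M i) (M i)"
    and subst: "\<And>i f. f \<in> borel_measurable (M i) \<Longrightarrow>
      (\<integral>\<^sup>+y. f (\<phi> i y) * w i y \<partial>M i) = (\<integral>\<^sup>+y. f y * u i y \<partial>M i)"
    and "F \<in> borel_measurable (PiM I M)"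
  shows "(\<integral>\<^sup>+x. F (\<lambda>i\<in>I. \<phi> i (x i)) * (\<Prod>i\<in>I. w i (x i)) \<partial>PiM I M) =
    (\<integral>\<^sup>+x. F x * (\<Prod>i\<in>I. u i (x i)) \<partial>PiM I M)"
  using assms(1,6)
proof (induction I arbitrary: F)
  case empty
  show ?case
    by (intro nn_integral_cong) (simp add: space_PiM restrict_def)
next
  case (insert i I)
  note [measurable] = insert.prems
  define G where "G z = (\<integral>\<^sup>+y. F (z(i := y)) * u i y \<partial>M i)" for z
  have [measurable]: "G \<in> borel_measurable (PiM I M)"
    unfolding G_def by measurable
  have neq: "j \<noteq> i" if "j \<in> I" for j using that insert.hyps by auto
  have restr: "(\<lambda>j\<in>insert i I. \<phi> j ((x(i := y)) j)) = (\<lambda>j\<in>I. \<phi> j (x j))(i := \<phi> i y)" for x y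
    using neq by (auto simp: fun_eq_iff)
  have prodw: "(\<Prod>j\<in>insert i I. v j ((x(i := y)) j)) = v i y * (\<Prod>j\<in>I. v j (x j))"
    for x y and v :: "'i \<Rightarrow> 'a \<Rightarrow> ennreal"
    using insert.hyps neq by (simp add: prod.insert)
  have "(\<integral>\<^sup>+x. F (\<lambda>j\<in>insert i I. \<phi> j (x j)) * (\<Prod>j\<in>insert i I. w j (x j)) \<partial>PiM (insert i I) M)
    = (\<integral>\<^sup>+x. (\<integral>\<^sup>+y. F ((\<lambda>j\<in>I. \<phi> j (x j))(i := \<phi> i y)) * (w i y * (\<Prod>j\<in>I. w j (x j))) \<partial>M i) \<partial>PiM I M)"
    by (subst product_nn_integral_insert[OF insert.hyps]) (measurable, simp only: restr prodw)
  also have "\<dots> = (\<integral>\<^sup>+x. G (\<lambda>j\<in>I. \<phi> j (x j)) * (\<Prod>j\<in>I. w j (x j)) \<partial>PiM I M)"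
  proof (intro nn_integral_cong)
    fix x assume x: "x \<in> space (PiM I M)"
    have z: "(\<lambda>j\<in>I. \<phi> j (x j)) \<in> space (PiM I M)"
      using x measurable_space[OF assms(4)] by (auto simp: space_PiM PiE_iff)
    have m: "(\<lambda>y. F ((\<lambda>j\<in>I. \<phi> j (x j))(i := y))) \<in> borel_measurable (M i)"
      using z by measurable
    show "(\<integral>\<^sup>+y. F ((\<lambda>j\<in>I. \<phi> j (x j))(i := \<phi> i y)) * (w i y * (\<Prod>j\<in>I. w j (x j))) \<partial>M i)
      = G (\<lambda>j\<in>I. \<phi> j (x j)) * (\<Prod>j\<in>I. w j (x j))"
      unfolding G_def subst[OF m, symmetric]
      using z by (subst nn_integral_multc[symmetric]) (auto simp: mult.assoc)
  qed
  also have "\<dots> = (\<integral>\<^sup>+x. G x * (\<Prod>j\<in>I. u j (x j)) \<partial>PiM I M)"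
    by (rule insert.IH) measurable
  also have "\<dots> = (\<integral>\<^sup>+x. F x * (\<Prod>j\<in>insert i I. u j (x j)) \<partial>PiM (insert i I) M)"
    unfolding G_def
    by (subst product_nn_integral_insert[OF insert.hyps])
       (measurable, simp only: prodw, intro nn_integral_cong,
        subst nn_integral_multc[symmetric], auto simp: mult.assoc)
  finally show ?case .
qed

text \<open>Both signs follow from \<open>exp u \<ge> 1 + u\<close>, taken at \<open>u = - s\<close>
  and at \<open>u = s\<close>. The bound will dominate the difference quotients of
  \<open>exp (S t x)\<close>.\<close>

lemma abs_exp_minus_one_le: "\<bar>exp s - 1\<bar> \<le> \<bar>s\<bar> * exp \<bar>s\<bar>" for s :: real
proof (cases "s \<ge> 0")
  case True
  have "exp s * (1 - s) \<le> exp s * exp (- s)"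
    using exp_ge_add_one_self[of "- s"] by (intro mult_left_mono) auto
  then show ?thesis
    using True by (simp add: algebra_simps flip: exp_add)
next
  case False
  have "1 - exp s \<le> - s * 1"
    using exp_ge_add_one_self[of s] by linarith
  also have "\<dots> \<le> - s * exp (- s)"
    using False by (intro mult_left_mono) auto
  finally show ?thesis
    using False by simp
qed

lemma abs_ln_one_plus_le: "\<bar>ln (1 + u)\<bar> \<le> 2 * \<bar>u\<bar>" if "\<bar>u\<bar> \<le> 1 / 2" for u :: real
proof -
  have "\<bar>ln (1 + u) - u\<bar> \<le> 2 * u\<^sup>2"
    using abs_ln_one_plus_x_minus_x_bound that by blast
  moreover have "2 * u\<^sup>2 \<le> \<bar>u\<bar>"
    using mult_right_mono[OF that abs_ge_zero[of u]] by (simp add: power2_eq_square)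
  ultimately show ?thesis by linarith
qed

text \<open>Dominated convergence for the difference quotients of \<open>exp (S t x)\<close> at
  \<open>t = 0\<close>. The bound \<open>K * \<bar>t\<bar>\<close> serves twice: it forces
  \<open>S 0 x = 0\<close>, and it dominates the quotients by a constant, which is integrable
  because the measure is finite. The observable \<open>f\<close> stays fixed; in the application its
  own change under the flow is a part of \<open>S\<close>.\<close>

lemma integral_exp_variation_eq_0:
  fixes f D :: "'a \<Rightarrow> real" and S :: "real \<Rightarrow> 'a \<Rightarrow> real"
  assumes "finite_measure M" and "\<epsilon> > 0"
    and [measurable]: "f \<in> borel_measurable M" "D \<in> borel_measurable M"
      "\<And>t. S t \<in> borel_measurable M"
    and f_bound: "AE x in M. \<bar>f x\<bar> \<le> B"
    and S_bound: "AE x in M. \<forall>t. \<bar>t\<bar> \<le> \<epsilon> \<longrightarrow> \<bar>S t x\<bar> \<le> K * \<bar>t\<bar>"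
    and S_deriv: "AE x in M. ((\<lambda>t. S t x) has_real_derivative D x) (at 0)"
    and invariant: "\<And>t. 0 < t \<Longrightarrow> t \<le> \<epsilon> \<Longrightarrow> (\<integral>x. f x * exp (S t x) \<partial>M) = (\<integral>x. f x \<partial>M)"
  shows "(\<integral>x. f x * D x \<partial>M) = 0"
proof -
  interpret finite_measure M by fact
  \<comment> \<open>Dominated convergence is about sequences, so \<open>t\<close> runs through
    values decreasing to 0 inside the range where the invariance is assumed.\<close>
  define \<tau> where "\<tau> n = \<epsilon> / real (Suc n)" for n
  have \<tau>: "0 < \<tau> n" "\<tau> n \<le> \<epsilon>" for n
    using \<open>\<epsilon> > 0\<close> by (auto simp: \<tau>_def field_simps mult_le_cancel_left)
  have \<tau>_neq: "\<tau> n \<noteq> 0" for n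
    using \<tau>(1)[of n] by simp
  have \<tau>_lim: "\<tau> \<longlonglongrightarrow> 0"
    unfolding \<tau>_def using LIMSEQ_Suc[OF lim_const_over_n[of \<epsilon>]] by simp
  have int_f: "integrable M f"
    using f_bound by (intro integrable_const_bound[where B = B]) auto
  have "(\<lambda>n. \<integral>x. f x * ((exp (S (\<tau> n) x) - 1) / \<tau> n) \<partial>M) \<longlonglongrightarrow> (\<integral>x. f x * D x \<partial>M)"
  proof (rule integral_dominated_convergence)
    show "integrable M (\<lambda>_. B * (K * exp (K * \<epsilon>)))" by simp
    show "AE x in M. (\<lambda>n. f x * ((exp (S (\<tau> n) x) - 1) / \<tau> n)) \<longlonglongrightarrow> f x * D x"
      using S_bound S_deriv
    proof eventually_elim
      case (elim x)
      have S0: "S 0 x = 0" using elim(1)[rule_format, of 0] \<open>\<epsilon> > 0\<close> by simp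
      have "((\<lambda>t. exp (S t x)) has_real_derivative D x) (at 0)"
        using DERIV_fun_exp[OF elim(2)] S0 by simp
      then have "((\<lambda>t. (exp (S t x) - 1) / t) \<longlongrightarrow> D x) (at 0)"
        by (simp add: has_field_derivative_iff S0)
      then have "(\<lambda>n. (exp (S (\<tau> n) x) - 1) / \<tau> n) \<longlonglongrightarrow> D x"
        by (rule filterlim_compose)
           (use \<tau>_lim \<tau>_neq in \<open>auto simp: filterlim_at\<close>)
      then show ?case by (intro tendsto_intros)
    qed
    show "AE x in M. norm (f x * ((exp (S (\<tau> n) x) - 1) / \<tau> n)) \<le> B * (K * exp (K * \<epsilon>))" for n
      using f_bound S_bound
    proof eventually_elim
      case (elim x)
      have K: "\<bar>S (\<tau> n) x\<bar> \<le> K * \<tau> n" using elim(2)[rule_format, of "\<tau> n"] \<tau>[of n] by simp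
      then have "0 \<le> K" using \<tau>(1)[of n]
        by (smt (verit) mult_neg_pos)
      have "\<bar>exp (S (\<tau> n) x) - 1\<bar> \<le> \<bar>S (\<tau> n) x\<bar> * exp \<bar>S (\<tau> n) x\<bar>"
        by (rule abs_exp_minus_one_le)
      also have "\<dots> \<le> (K * \<tau> n) * exp (K * \<epsilon>)"
        using K \<tau>[of n] \<open>0 \<le> K\<close>
        by (intro mult_mono) (auto intro: order_trans mult_left_mono)
      finally have "\<bar>(exp (S (\<tau> n) x) - 1) / \<tau> n\<bar> \<le> K * exp (K * \<epsilon>)"
        using \<tau>(1)[of n] by (simp add: field_simps)
      with elim(1) show ?case
        using \<open>0 \<le> K\<close> unfolding real_norm_def abs_mult by (intro mult_mono) auto
    qed
  qed measurable
  \<comment> \<open>Before the limit each integral is already 0: by \<open>invariant\<close> the two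
    halves of the difference quotient have equal integrals, and both halves are integrable.\<close>
  moreover have "(\<integral>x. f x * ((exp (S (\<tau> n) x) - 1) / \<tau> n) \<partial>M) = 0" for n
  proof -
    have "integrable M (\<lambda>x. f x * exp (S (\<tau> n) x))"
    proof (rule integrable_const_bound[where B = "B * exp (K * \<epsilon>)"])
      show "AE x in M. norm (f x * exp (S (\<tau> n) x)) \<le> B * exp (K * \<epsilon>)"
        using f_bound S_bound
      proof eventually_elim
        case (elim x)
        have K: "\<bar>S (\<tau> n) x\<bar> \<le> K * \<tau> n" using elim(2)[rule_format, of "\<tau> n"] \<tau>[of n] by simp
        then have "0 \<le> K" using \<tau>(1)[of n] by (smt (verit) mult_neg_pos)
        then have "K * \<tau> n \<le> K * \<epsilon>" using \<tau>(2)[of n] by (intro mult_left_mono)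
        with elim(1) K show ?case
          unfolding real_norm_def abs_mult by (intro mult_mono) auto
      qed
    qed measurable
    then have "(\<integral>x. (f x * exp (S (\<tau> n) x) - f x) / \<tau> n \<partial>M) = 0"
      using int_f invariant[OF \<tau>] by simp
    then show ?thesis
      by (simp add: algebra_simps)
  qed
  ultimately show ?thesis
    by (simp only: LIMSEQ_const_iff)
qed

section \<open>The flow on configurations\<close>

text \<open>The velocity \<open>x - x ^ Suc p\<close> is the telescoping sum of the fields
  \<open>x ^ s * (1 - x)\<close> for \<open>s = 1..p\<close>, whence a loop equation summed over
  these powers.\<close>

definition jacobi_flow :: "nat \<Rightarrow> real \<Rightarrow> real \<Rightarrow> real" where
  "jacobi_flow p t x = x + t * (x - x ^ Suc p)"

text \<open>The logarithm of the factor by which the weight times Lebesgue measure changes along the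
  flow. The three sums come from the Jacobian determinant, the factors at the endpoints 0 and 1, and
  the pair interaction. Every logarithm has the form \<open>ln (1 + t * a)\<close>, so that all are
  estimated and differentiated alike.\<close>

definition jacobi_log_jacobian :: "nat \<Rightarrow> nat \<Rightarrow> real \<Rightarrow> real \<Rightarrow> real \<Rightarrow> real \<Rightarrow> (nat \<Rightarrow> real) \<Rightarrow> real" where
  "jacobi_log_jacobian p N \<alpha>1 \<alpha>2 \<beta> t x =
     (\<Sum>k<N. ln (1 + t * (1 - real (Suc p) * x k ^ p))) +
     (\<Sum>k<N. \<alpha>1 * ln (1 + t * (1 - x k ^ p)) + \<alpha>2 * ln (1 + t * - (\<Sum>s = 1..p. x k ^ s))) +
     (\<Sum>k<N. \<Sum>j<k. \<beta> * ln (1 + t * (1 - (\<Sum>s\<le>p. x k ^ s * x j ^ (p - s)))))"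

text \<open>The derivative of \<open>jacobi_log_jacobian\<close> at \<open>t = 0\<close>, obtained
  by replacing each \<open>ln (1 + t * a)\<close> by its rate \<open>a\<close>.\<close>

definition jacobi_loop_stat :: "nat \<Rightarrow> nat \<Rightarrow> real \<Rightarrow> real \<Rightarrow> real \<Rightarrow> (nat \<Rightarrow> real) \<Rightarrow> real" where
  "jacobi_loop_stat p N \<alpha>1 \<alpha>2 \<beta> x =
     (\<Sum>k<N. 1 - real (Suc p) * x k ^ p) +
     (\<Sum>k<N. \<alpha>1 * (1 - x k ^ p) + \<alpha>2 * - (\<Sum>s = 1..p. x k ^ s)) +
     (\<Sum>k<N. \<Sum>j<k. \<beta> * (1 - (\<Sum>s\<le>p. x k ^ s * x j ^ (p - s))))"

section \<open>Measurability, and bounds for the rates on the unit interval\<close>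

lemma jacobi_weight_measurable [measurable]:
  "jacobi_weight N \<alpha>1 \<alpha>2 \<beta> \<in> borel_measurable (PiM {..<N} (\<lambda>_. lborel))"
proof -
  have [measurable]: "PiE {..<N} (\<lambda>_. {0<..<1::real}) \<in> sets (PiM {..<N} (\<lambda>_. lborel))"
    by (intro sets_PiM_I_finite) auto
  have "j < N" if "j < k" "k < N" for j k using that by auto
  then show ?thesis
    unfolding jacobi_weight_def by measurable
qed

lemma jacobi_weight_nonneg: "jacobi_weight N \<alpha>1 \<alpha>2 \<beta> x \<ge> 0"
  unfolding jacobi_weight_def by (intro mult_nonneg_nonneg prod_nonneg ballI) auto

lemma jacobi_log_jacobian_measurable [measurable]:
  "jacobi_log_jacobian p N \<alpha>1 \<alpha>2 \<beta> t \<in> borel_measurable (PiM {..<N} (\<lambda>_. lborel))"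
proof -
  have "j < N" if "j < k" "k < N" for j k using that by auto
  then show ?thesis
    unfolding jacobi_log_jacobian_def by measurable
qed

lemma jacobi_loop_stat_measurable [measurable]:
  "jacobi_loop_stat p N \<alpha>1 \<alpha>2 \<beta> \<in> borel_measurable (PiM {..<N} (\<lambda>_. lborel))"
proof -
  have "j < N" if "j < k" "k < N" for j k using that by auto
  then show ?thesis
    unfolding jacobi_loop_stat_def by measurable
qed

lemma jacobi_rate_bounds:
  fixes x :: real
  assumes "0 \<le> x" "x \<le> 1"
  shows "\<bar>1 - real (Suc p) * x ^ p\<bar> \<le> real (Suc p)"
    and "\<bar>1 - x ^ p\<bar> \<le> real (Suc p)"
    and "\<bar>- (\<Sum>s = 1..p. x ^ s)\<bar> \<le> real (Suc p)"
proof -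
  have pow: "0 \<le> x ^ s" "x ^ s \<le> 1" for s
    using assms by (auto intro: power_le_one)
  have "\<bar>1 - u\<bar> \<le> c" if "0 \<le> u" "u \<le> c" "1 \<le> c" for u c :: real
    using that by linarith
  then show "\<bar>1 - real (Suc p) * x ^ p\<bar> \<le> real (Suc p)"
    using pow[of p] by (simp add: mult_left_le)
  show "\<bar>1 - x ^ p\<bar> \<le> real (Suc p)" using pow[of p] by simp
  have "0 \<le> (\<Sum>s = 1..p. x ^ s)" "(\<Sum>s = 1..p. x ^ s) \<le> real (card {1..p}) * 1"
    using pow by (intro sum_nonneg sum_bounded_above; simp)+
  then show "\<bar>- (\<Sum>s = 1..p. x ^ s)\<bar> \<le> real (Suc p)" by simp
qed

lemma jacobi_pair_rate_bound:
  fixes x y :: real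
  assumes "0 \<le> x" "x \<le> 1" "0 \<le> y" "y \<le> 1"
  shows "\<bar>1 - (\<Sum>s\<le>p. x ^ s * y ^ (p - s))\<bar> \<le> real (Suc p)"
proof -
  have pow: "0 \<le> x ^ s" "x ^ s \<le> 1" "0 \<le> y ^ s" "y ^ s \<le> 1" for s
    using assms by (auto intro: power_le_one)
  have "0 \<le> (\<Sum>s\<le>p. x ^ s * y ^ (p - s))"
    using pow by (intro sum_nonneg) auto
  moreover have "(\<Sum>s\<le>p. x ^ s * y ^ (p - s)) \<le> real (card {..p}) * 1"
    using pow by (intro sum_bounded_above) (auto intro: mult_le_one)
  ultimately show ?thesis
    by simp
qed

text \<open>All rates are bounded by \<open>real (Suc p)\<close>, so this single time range keeps
  every factor \<open>1 + t * a\<close> at least 1/2, and \<open>abs_ln_one_plus_le\<close> applies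
  to its logarithm.\<close>

lemma small_time_mult:
  fixes t a :: real
  assumes "\<bar>t\<bar> \<le> 1 / (2 * real (Suc p))" "\<bar>a\<bar> \<le> real (Suc p)"
  shows "\<bar>t * a\<bar> \<le> 1 / 2"
proof -
  have "\<bar>t\<bar> * \<bar>a\<bar> \<le> (1 / (2 * real (Suc p))) * real (Suc p)"
    using assms by (intro mult_mono) auto
  also have "\<dots> = 1 / 2" by (simp add: field_simps)
  finally show ?thesis by (simp add: abs_mult)
qed

section \<open>Transport of the weight along the flow\<close>

lemma jacobi_flow_deriv:
  "(jacobi_flow p t has_real_derivative 1 + t * (1 - real (Suc p) * x ^ p)) (at x)"
  unfolding jacobi_flow_def
  by (rule derivative_eq_intros refl | simp add: algebra_simps del: power_Suc)+

lemma jacobi_flow_eq_mult: "jacobi_flow p t x = x * (1 + t * (1 - x ^ p))"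
  by (simp add: jacobi_flow_def algebra_simps)

text \<open>The velocity vanishes at 1, and the geometric sum supplies the cofactor of
  \<open>1 - x\<close>. Thus the distance to this endpoint is only multiplied by a factor close to
  1.\<close>

lemma one_minus_jacobi_flow:
  "1 - jacobi_flow p t x = (1 - x) * (1 + t * - (\<Sum>s = 1..p. x ^ s))"
proof -
  have "x - x ^ Suc p = x * ((1 - x) * (\<Sum>i<p. x ^ i))"
    by (subst one_diff_power_eq[symmetric]) (simp add: algebra_simps)
  also have "\<dots> = (1 - x) * (\<Sum>s = 1..p. x ^ s)"
    by (simp add: sum_distrib_left sum.atLeast1_atMost_eq mult_ac)
  finally have "1 - (x + t * (x - x ^ Suc p)) = 1 - (x + t * ((1 - x) * (\<Sum>s = 1..p. x ^ s)))"
    by (simp only:)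
  then show ?thesis
    unfolding jacobi_flow_def by (simp only:) (simp add: algebra_simps)
qed

text \<open>A difference of powers is divisible by \<open>x - y\<close>. Hence the flow multiplies
  each distance between particles by a factor bounded above and away from 0, and the singular
  \<open>\<bar>x - y\<bar> powr \<beta>\<close> changes in a controlled way for either sign of
  \<open>\<beta>\<close>.\<close>

lemma jacobi_flow_diff:
  "jacobi_flow p t x - jacobi_flow p t y =
     (x - y) * (1 + t * (1 - (\<Sum>s\<le>p. x ^ s * y ^ (p - s))))"
proof -
  have "x ^ Suc p - y ^ Suc p = (x - y) * (\<Sum>s\<le>p. x ^ s * y ^ (p - s))"
    using diff_power_eq_sum[of x p y] by (simp only: lessThan_Suc_atMost)
  then have "(x - y) + t * ((x - y) - (x ^ Suc p - y ^ Suc p)) =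
      (x - y) * (1 + t * (1 - (\<Sum>s\<le>p. x ^ s * y ^ (p - s))))"
    by (simp only:) (simp only: algebra_simps mult_1_right)
  then show ?thesis
    unfolding jacobi_flow_def by (simp add: algebra_simps)
qed

lemma jacobi_flow_in_unit_interval:
  assumes t: "\<bar>t\<bar> \<le> 1 / (2 * real (Suc p))" and x: "0 < x" "x < 1"
  shows "0 < jacobi_flow p t x" "jacobi_flow p t x < 1"
proof -
  have *: "1 + t * a > 0" if "\<bar>a\<bar> \<le> real (Suc p)" for a
    using small_time_mult[OF t that] by linarith
  show "0 < jacobi_flow p t x"
    using x unfolding jacobi_flow_eq_mult by (intro mult_pos_pos * jacobi_rate_bounds) auto
  have "0 < 1 - jacobi_flow p t x"
    using x unfolding one_minus_jacobi_flow by (intro mult_pos_pos * jacobi_rate_bounds) auto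
  then show "jacobi_flow p t x < 1" by simp
qed

text \<open>Each factor of the weight is a power of \<open>x k\<close>, \<open>1 - x k\<close> or
  \<open>\<bar>x k - x j\<bar>\<close>, and the flow multiplies each of these bases by some positive
  \<open>1 + t * a\<close>. Taking the power turns this into the factor
  \<open>exp (b * ln (1 + t * a))\<close>.\<close>

lemma jacobi_weight_flow:
  assumes t: "\<bar>t\<bar> \<le> 1 / (2 * real (Suc p))" and x: "x \<in> PiE {..<N} (\<lambda>_. {0<..<1})"
  shows "jacobi_weight N \<alpha>1 \<alpha>2 \<beta> (\<lambda>k\<in>{..<N}. jacobi_flow p t (x k)) *
      (\<Prod>k<N. 1 + t * (1 - real (Suc p) * x k ^ p)) =
    jacobi_weight N \<alpha>1 \<alpha>2 \<beta> x * exp (jacobi_log_jacobian p N \<alpha>1 \<alpha>2 \<beta> t x)"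
proof -
  have pos: "1 + t * a > 0" if "\<bar>a\<bar> \<le> real (Suc p)" for a
    using small_time_mult[OF t that] by linarith
  have x01: "0 < x k" "x k < 1" if "k < N" for k
    using x that by (auto simp: PiE_iff)
  \<comment> \<open>The base \<open>z = 0\<close> is included to cover coinciding particles, where
    both sides are 0.\<close>
  have powr_eq: "(z * (1 + t * a)) powr b = z powr b * exp (b * ln (1 + t * a))"
    if "z \<ge> 0" "\<bar>a\<bar> \<le> real (Suc p)" for z a b
    using that pos[OF that(2)] by (simp add: powr_mult powr_def[of "1 + t * a"])
  have mem: "(\<lambda>k\<in>{..<N}. jacobi_flow p t (x k)) \<in> PiE {..<N} (\<lambda>_. {0<..<1})"
    using jacobi_flow_in_unit_interval[OF t] x01 by auto
  have ends: "jacobi_flow p t (x k) powr \<alpha>1 * (1 - jacobi_flow p t (x k)) powr \<alpha>2 =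
      (x k powr \<alpha>1 * (1 - x k) powr \<alpha>2) *
      exp (\<alpha>1 * ln (1 + t * (1 - x k ^ p)) + \<alpha>2 * ln (1 + t * - (\<Sum>s = 1..p. x k ^ s)))"
    if "k < N" for k
  proof -
    have "jacobi_flow p t (x k) powr \<alpha>1 = x k powr \<alpha>1 * exp (\<alpha>1 * ln (1 + t * (1 - x k ^ p)))"
      unfolding jacobi_flow_eq_mult
      using x01[OF that] by (intro powr_eq jacobi_rate_bounds) auto
    moreover have "(1 - jacobi_flow p t (x k)) powr \<alpha>2 =
        (1 - x k) powr \<alpha>2 * exp (\<alpha>2 * ln (1 + t * - (\<Sum>s = 1..p. x k ^ s)))"
      unfolding one_minus_jacobi_flow
      using x01[OF that] by (intro powr_eq jacobi_rate_bounds) auto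
    ultimately show ?thesis by (simp add: exp_add mult_ac)
  qed
  have pairs: "\<bar>jacobi_flow p t (x k) - jacobi_flow p t (x j)\<bar> powr \<beta> =
      \<bar>x k - x j\<bar> powr \<beta> * exp (\<beta> * ln (1 + t * (1 - (\<Sum>s\<le>p. x k ^ s * x j ^ (p - s)))))"
    if "k < N" "j < k" for k j
  proof -
    have j: "j < N" using that by simp
    have b: "\<bar>1 - (\<Sum>s\<le>p. x k ^ s * x j ^ (p - s))\<bar> \<le> real (Suc p)"
      using x01[OF that(1)] x01[OF j] by (intro jacobi_pair_rate_bound) auto
    show ?thesis
      unfolding jacobi_flow_diff abs_mult abs_of_pos[OF pos[OF b]]
      by (intro powr_eq b) auto
  qed
  have deriv: "1 + t * (1 - real (Suc p) * x k ^ p) = exp (ln (1 + t * (1 - real (Suc p) * x k ^ p)))"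
    if "k < N" for k
    using x01[OF that] by (intro exp_ln[symmetric] pos jacobi_rate_bounds) auto
  have "(\<Prod>k<N. 1 + t * (1 - real (Suc p) * x k ^ p)) =
      exp (\<Sum>k<N. ln (1 + t * (1 - real (Suc p) * x k ^ p)))"
    unfolding exp_sum[OF finite_lessThan] using deriv by (intro prod.cong) auto
  moreover have "(\<Prod>k<N. jacobi_flow p t (x k) powr \<alpha>1 * (1 - jacobi_flow p t (x k)) powr \<alpha>2) =
      (\<Prod>k<N. x k powr \<alpha>1 * (1 - x k) powr \<alpha>2) *
      exp (\<Sum>k<N. \<alpha>1 * ln (1 + t * (1 - x k ^ p)) + \<alpha>2 * ln (1 + t * - (\<Sum>s = 1..p. x k ^ s)))"
    unfolding exp_sum[OF finite_lessThan] prod.distrib[symmetric]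
    using ends by (intro prod.cong) auto
  moreover have "(\<Prod>k<N. \<Prod>j<k. \<bar>jacobi_flow p t (x k) - jacobi_flow p t (x j)\<bar> powr \<beta>) =
      (\<Prod>k<N. \<Prod>j<k. \<bar>x k - x j\<bar> powr \<beta>) *
      exp (\<Sum>k<N. \<Sum>j<k. \<beta> * ln (1 + t * (1 - (\<Sum>s\<le>p. x k ^ s * x j ^ (p - s)))))"
    unfolding exp_sum[OF finite_lessThan] prod.distrib[symmetric]
    using pairs by (intro prod.cong) auto
  moreover have "jacobi_weight N \<alpha>1 \<alpha>2 \<beta> (\<lambda>k\<in>{..<N}. jacobi_flow p t (x k)) =
      (\<Prod>k<N. jacobi_flow p t (x k) powr \<alpha>1 * (1 - jacobi_flow p t (x k)) powr \<alpha>2) *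
      (\<Prod>k<N. \<Prod>j<k. \<bar>jacobi_flow p t (x k) - jacobi_flow p t (x j)\<bar> powr \<beta>)"
    using mem unfolding jacobi_weight_def by (auto intro!: arg_cong2[where f = "(*)"] prod.cong)
  moreover have "jacobi_weight N \<alpha>1 \<alpha>2 \<beta> x =
      (\<Prod>k<N. x k powr \<alpha>1 * (1 - x k) powr \<alpha>2) * (\<Prod>k<N. \<Prod>j<k. \<bar>x k - x j\<bar> powr \<beta>)"
    using x unfolding jacobi_weight_def by simp
  ultimately show ?thesis
    unfolding jacobi_log_jacobian_def exp_add by (simp only: mult_ac)
qed

text \<open>The flow fixes 0 and 1 and has nonnegative derivative on the unit interval, so
  substitution carries the interval onto itself.\<close>

lemma nn_integral_jacobi_flow:
  fixes f :: "real \<Rightarrow> ennreal"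
  assumes "f \<in> borel_measurable borel" and t: "\<bar>t\<bar> \<le> 1 / (2 * real (Suc p))"
  shows "(\<integral>\<^sup>+y. f (jacobi_flow p t y) *
      (ennreal (1 + t * (1 - real (Suc p) * y ^ p)) * indicator {0..1} y) \<partial>lborel) =
    (\<integral>\<^sup>+y. f y * indicator {0..1} y \<partial>lborel)"
proof -
  have "(\<integral>\<^sup>+y. f y * indicator {jacobi_flow p t 0..jacobi_flow p t 1} y \<partial>lborel) =
    (\<integral>\<^sup>+y. f (jacobi_flow p t y) * ennreal (1 + t * (1 - real (Suc p) * y ^ p)) *
      indicator {0..1} y \<partial>lborel)"
  proof (rule nn_integral_substitution_aux)
    show "0 \<le> 1 + t * (1 - real (Suc p) * x ^ p)" if "x \<in> {0..1}" for x
      using small_time_mult[OF t jacobi_rate_bounds(1)[of x p]] that by auto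
  qed (use assms jacobi_flow_deriv in \<open>auto intro!: continuous_intros\<close>)
  then show ?thesis by (simp add: jacobi_flow_def mult.assoc)
qed

lemma nn_integral_jacobi_weight_flow:
  fixes f :: "(nat \<Rightarrow> real) \<Rightarrow> real"
  assumes t: "\<bar>t\<bar> \<le> 1 / (2 * real (Suc p))"
    and [measurable]: "f \<in> borel_measurable (PiM {..<N} (\<lambda>_. lborel))"
  shows "(\<integral>\<^sup>+x. ennreal (jacobi_weight N \<alpha>1 \<alpha>2 \<beta> x * exp (jacobi_log_jacobian p N \<alpha>1 \<alpha>2 \<beta> t x)
        * f (\<lambda>k\<in>{..<N}. jacobi_flow p t (x k))) \<partial>PiM {..<N} (\<lambda>_. lborel)) =
    (\<integral>\<^sup>+x. ennreal (jacobi_weight N \<alpha>1 \<alpha>2 \<beta> x * f x) \<partial>PiM {..<N} (\<lambda>_. lborel))"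
proof -
  interpret product_sigma_finite "\<lambda>_ :: nat. lborel :: real measure" ..
  let ?Q = "PiM {..<N} (\<lambda>_. lborel :: real measure)"
  let ?D = "PiE {..<N} (\<lambda>_. {0<..<1::real})"
  let ?W = "jacobi_weight N \<alpha>1 \<alpha>2 \<beta>"
  let ?\<Phi> = "\<lambda>x. \<lambda>k\<in>{..<N}. jacobi_flow p t (x k)"
  let ?J = "\<lambda>y. 1 + t * (1 - real (Suc p) * y ^ p)"
  define F where "F x = ennreal (?W x * f x)" for x
  have [measurable]: "F \<in> borel_measurable ?Q"
    unfolding F_def by measurable
  have W0: "?W x = 0" if "x \<notin> ?D" for x
    using that by (simp add: jacobi_weight_def)
  have J: "?J y \<ge> 0" if "0 \<le> y" "y \<le> 1" for y
    using small_time_mult[OF t jacobi_rate_bounds(1)[OF that, of p]] by linarith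
  have "(\<integral>\<^sup>+x. ennreal (?W x * exp (jacobi_log_jacobian p N \<alpha>1 \<alpha>2 \<beta> t x) * f (?\<Phi> x)) \<partial>?Q) =
    (\<integral>\<^sup>+x. F (?\<Phi> x) * (\<Prod>k<N. ennreal (?J (x k)) * indicator {0..1} (x k)) \<partial>?Q)"
  proof (intro nn_integral_cong)
    fix x assume x: "x \<in> space ?Q"
    show "ennreal (?W x * exp (jacobi_log_jacobian p N \<alpha>1 \<alpha>2 \<beta> t x) * f (?\<Phi> x)) =
      F (?\<Phi> x) * (\<Prod>k<N. ennreal (?J (x k)) * indicator {0..1} (x k))"
    proof (cases "x \<in> ?D")
      case True
      then have x01: "0 \<le> x k \<and> x k \<le> 1" if "k < N" for k
        using PiE_mem[OF True, of k] that by auto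
      have "(\<Prod>k<N. ennreal (?J (x k)) * indicator {0..1} (x k)) = (\<Prod>k<N. ennreal (?J (x k)))"
        using x01 by (intro prod.cong) auto
      also have "\<dots> = ennreal (\<Prod>k<N. ?J (x k))"
        using x01 J by (intro prod_ennreal) auto
      finally have "F (?\<Phi> x) * (\<Prod>k<N. ennreal (?J (x k)) * indicator {0..1} (x k)) =
          ennreal ((?W (?\<Phi> x) * f (?\<Phi> x)) * (\<Prod>k<N. ?J (x k)))"
        \<comment> \<open>The function \<open>f\<close> may be negative, where
          \<open>ennreal\<close> truncates to 0; multiplying by the nonnegative Jacobian commutes
          with this truncation.\<close>
        unfolding F_def using x01 J by (simp only:) (intro ennreal_mult''[symmetric] prod_nonneg, auto)
      also have "(?W (?\<Phi> x) * f (?\<Phi> x)) * (\<Prod>k<N. ?J (x k)) =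
          (?W (?\<Phi> x) * (\<Prod>k<N. ?J (x k))) * f (?\<Phi> x)"
        by (simp only: mult_ac)
      finally show ?thesis
        unfolding jacobi_weight_flow[OF t True] by (rule sym)
    next
      case False
      then obtain k where k: "k < N" "x k \<notin> {0<..<1}"
        using x by (auto simp: space_PiM PiE_iff)
      \<comment> \<open>Outside the open cube both sides vanish: a coordinate outside the closed
        interval makes an indicator 0, while a coordinate equal to 0 or 1 is fixed by the flow, so
        the moved configuration is outside the open cube too.\<close>
      have "x k \<notin> {0..1} \<or> ?\<Phi> x \<notin> ?D"
      proof (cases "x k \<in> {0..1}")
        case True
        then have "x k = 0 \<or> x k = 1" using k by auto
        then have "?\<Phi> x k \<notin> {0<..<1}" using k(1) by (auto simp: jacobi_flow_def)
        then show ?thesis using k(1) by (metis PiE_mem lessThan_iff)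
      qed simp
      then have "F (?\<Phi> x) * (\<Prod>k<N. ennreal (?J (x k)) * indicator {0..1} (x k)) = 0"
      proof
        assume "x k \<notin> {0..1}"
        then have "(\<Prod>k<N. ennreal (?J (x k)) * indicator {0..1} (x k)) = 0"
          using k(1) by (intro prod_zero bexI[of _ k]) auto
        then show ?thesis by (simp only: mult_zero_right)
      next
        assume "?\<Phi> x \<notin> ?D"
        then have "?W (?\<Phi> x) = 0" by (rule W0)
        then have "F (?\<Phi> x) = 0" by (simp only: F_def mult_zero_left ennreal_0)
        then show ?thesis by (simp only: mult_zero_left)
      qed
      then show ?thesis by (simp only: W0[OF False] mult_zero_left ennreal_0)
    qed
  qed
  also have "\<dots> = (\<integral>\<^sup>+x. F x * (\<Prod>k<N. indicator {0..1} (x k)) \<partial>?Q)"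
  proof (rule nn_integral_PiM_substitution)
    show "jacobi_flow p t \<in> measurable lborel lborel"
      unfolding jacobi_flow_def by measurable
    show "(\<integral>\<^sup>+y. g (jacobi_flow p t y) * (ennreal (?J y) * indicator {0..1} y) \<partial>lborel) =
      (\<integral>\<^sup>+y. g y * indicator {0..1} y \<partial>lborel)" if "g \<in> borel_measurable lborel" for g
      using that by (intro nn_integral_jacobi_flow t) simp
  qed simp_all
  also have "\<dots> = (\<integral>\<^sup>+x. F x \<partial>?Q)"
  proof (intro nn_integral_cong)
    fix x assume "x \<in> space ?Q"
    show "F x * (\<Prod>k<N. indicator {0..1} (x k)) = F x"
    proof (cases "x \<in> ?D")
      case True
      then have "(\<Prod>k<N. indicator {0..1} (x k)) = (\<Prod>k<N. 1::ennreal)"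
        by (intro prod.cong) (force simp: PiE_iff)+
      then show ?thesis by simp
    qed (simp add: F_def W0)
  qed
  finally show ?thesis unfolding F_def .
qed

section \<open>The ensemble as a measure, and its behaviour under the flow\<close>

lemma jacobi_partition_function_nonneg: "jacobi_partition_function N \<alpha>1 \<alpha>2 \<beta> \<ge> 0"
  unfolding jacobi_partition_function_def by (intro Bochner_Integration.integral_nonneg jacobi_weight_nonneg)

lemma sets_jacobi_ensemble [measurable_cong]:
  "sets (jacobi_ensemble N \<alpha>1 \<alpha>2 \<beta>) = sets (PiM {..<N} (\<lambda>_. lborel))"
  by (simp add: jacobi_ensemble_def)

lemma integral_jacobi_ensemble:
  fixes f :: "(nat \<Rightarrow> real) \<Rightarrow> real"
  assumes [measurable]: "f \<in> borel_measurable (PiM {..<N} (\<lambda>_. lborel))"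
  shows "(\<integral>x. f x \<partial>jacobi_ensemble N \<alpha>1 \<alpha>2 \<beta>) =
    (\<integral>x. jacobi_weight N \<alpha>1 \<alpha>2 \<beta> x * f x \<partial>PiM {..<N} (\<lambda>_. lborel)) /
      jacobi_partition_function N \<alpha>1 \<alpha>2 \<beta>"
  unfolding jacobi_ensemble_def
  by (subst integral_density)
     (auto simp: jacobi_weight_nonneg jacobi_partition_function_nonneg)

lemma AE_jacobi_ensemble:
  "AE x in jacobi_ensemble N \<alpha>1 \<alpha>2 \<beta>. x \<in> PiE {..<N} (\<lambda>_. {0<..<1})"
proof -
  have D: "x \<in> PiE {..<N} (\<lambda>_. {0<..<1})" if "jacobi_weight N \<alpha>1 \<alpha>2 \<beta> x \<noteq> 0" for x
    using that by (auto simp: jacobi_weight_def indicator_def split: if_splits)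
  then show ?thesis
    unfolding jacobi_ensemble_def by (subst AE_density, simp, intro AE_I2 impI D) auto
qed

text \<open>If the partition function is \<open>0\<close>, which includes the case of a weight that is not integrable,
  then division by zero makes the ensemble the null measure.\<close>

lemma finite_measure_jacobi_ensemble: "finite_measure (jacobi_ensemble N \<alpha>1 \<alpha>2 \<beta>)"
proof
  let ?Q = "PiM {..<N} (\<lambda>_. lborel :: real measure)"
  let ?Z = "jacobi_partition_function N \<alpha>1 \<alpha>2 \<beta>"
  have "emeasure (jacobi_ensemble N \<alpha>1 \<alpha>2 \<beta>) (space (jacobi_ensemble N \<alpha>1 \<alpha>2 \<beta>)) =
      (\<integral>\<^sup>+x. ennreal (jacobi_weight N \<alpha>1 \<alpha>2 \<beta> x / ?Z) \<partial>?Q)"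
    unfolding jacobi_ensemble_def by (simp add: emeasure_density cong: nn_integral_cong)
  also have "\<dots> < \<infinity>"
  proof (cases "?Z = 0")
    case False
    then have "integrable ?Q (jacobi_weight N \<alpha>1 \<alpha>2 \<beta>)"
      unfolding jacobi_partition_function_def using not_integrable_integral_eq by blast
    then have "integrable ?Q (\<lambda>x. jacobi_weight N \<alpha>1 \<alpha>2 \<beta> x / ?Z)" by simp
    then show ?thesis
      using integrableD(2)
      by (auto simp: integrable_iff_bounded jacobi_weight_nonneg jacobi_partition_function_nonneg)
  qed simp
  finally show "emeasure (jacobi_ensemble N \<alpha>1 \<alpha>2 \<beta>) (space (jacobi_ensemble N \<alpha>1 \<alpha>2 \<beta>)) \<noteq> \<infinity>"
    by simp
qed

text \<open>A nonzero partition function normalises the total mass to 1. The split allows the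
  covariance identities below to be stated for every \<open>N\<close> and \<open>\<beta>\<close>,
  since in the null case all integrals are 0.\<close>

lemma jacobi_ensemble_cases:
  obtains "jacobi_ensemble N \<alpha>1 \<alpha>2 \<beta> = null_measure (PiM {..<N} (\<lambda>_. lborel))"
  | "prob_space (jacobi_ensemble N \<alpha>1 \<alpha>2 \<beta>)"
proof (cases "jacobi_partition_function N \<alpha>1 \<alpha>2 \<beta> = 0")
  case True
  then have "jacobi_ensemble N \<alpha>1 \<alpha>2 \<beta> = null_measure (PiM {..<N} (\<lambda>_. lborel))"
    unfolding jacobi_ensemble_def by (intro measure_eqI) (auto simp: emeasure_density)
  then show ?thesis by fact
next
  case False
  interpret finite_measure "jacobi_ensemble N \<alpha>1 \<alpha>2 \<beta>"
    by (rule finite_measure_jacobi_ensemble)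
  have "(\<integral>x. 1 \<partial>jacobi_ensemble N \<alpha>1 \<alpha>2 \<beta>) = (1 :: real)"
    using False
    by (subst integral_jacobi_ensemble) (auto simp: jacobi_partition_function_def)
  then have "prob_space (jacobi_ensemble N \<alpha>1 \<alpha>2 \<beta>)"
    by (intro prob_spaceI) (simp add: emeasure_eq_measure)
  then show ?thesis by fact
qed

text \<open>The additional exponent \<open>real q * ln (1 + t * (1 - x j ^ p))\<close> turns
  \<open>x j ^ q\<close> into the same power of the moved particle. The equation is then the change
  of variables for the observable \<open>x j ^ q\<close>.\<close>

lemma integral_jacobi_ensemble_flow:
  assumes j: "j < N" and t: "\<bar>t\<bar> \<le> 1 / (2 * real (Suc p))"
  shows "(\<integral>x. x j ^ q * exp (jacobi_log_jacobian p N \<alpha>1 \<alpha>2 \<beta> t x + real q * ln (1 + t * (1 - x j ^ p)))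
      \<partial>jacobi_ensemble N \<alpha>1 \<alpha>2 \<beta>) = (\<integral>x. x j ^ q \<partial>jacobi_ensemble N \<alpha>1 \<alpha>2 \<beta>)"
proof -
  let ?Q = "PiM {..<N} (\<lambda>_. lborel :: real measure)"
  let ?W = "jacobi_weight N \<alpha>1 \<alpha>2 \<beta>"
  let ?L = "jacobi_log_jacobian p N \<alpha>1 \<alpha>2 \<beta> t"
  have "(\<lambda>x. x j) \<in> measurable ?Q lborel"
    using j by (intro measurable_component_singleton) auto
  then have [measurable]: "(\<lambda>x. x j) \<in> borel_measurable ?Q" by simp
  have W: "?W x = 0" if "\<not> (0 < x j \<and> x j < 1)" for x
    using that j by (auto simp: jacobi_weight_def PiE_iff indicator_def)
  have "(\<integral>x. ?W x * (x j ^ q * exp (?L x + real q * ln (1 + t * (1 - x j ^ p)))) \<partial>?Q) =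
      (\<integral>x. ?W x * exp (?L x) * jacobi_flow p t (x j) ^ q \<partial>?Q)"
  proof (intro Bochner_Integration.integral_cong refl)
    fix x
    show "?W x * (x j ^ q * exp (?L x + real q * ln (1 + t * (1 - x j ^ p)))) =
        ?W x * exp (?L x) * jacobi_flow p t (x j) ^ q"
    proof (cases "0 < x j \<and> x j < 1")
      case True
      then have "0 < 1 + t * (1 - x j ^ p)"
        using small_time_mult[OF t jacobi_rate_bounds(2)[of "x j" p]] by auto
      then show ?thesis
        by (simp add: jacobi_flow_eq_mult exp_add exp_of_nat_mult power_mult_distrib)
    qed (simp add: W)
  qed
  \<comment> \<open>The integrands are nonnegative, so both Bochner integrals are
    \<open>enn2real\<close> of extended integrals, which agree; an infinite value would yield 0 on
    both sides.\<close>
  also have "\<dots> = enn2real (\<integral>\<^sup>+x. ennreal (?W x * exp (?L x) *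
      (\<lambda>x. x j ^ q) (\<lambda>k\<in>{..<N}. jacobi_flow p t (x k))) \<partial>?Q)"
  proof (subst integral_eq_nn_integral)
    show "AE x in ?Q. 0 \<le> ?W x * exp (?L x) * jacobi_flow p t (x j) ^ q"
    proof (intro AE_I2)
      fix x
      show "0 \<le> ?W x * exp (?L x) * jacobi_flow p t (x j) ^ q"
        using jacobi_flow_in_unit_interval[OF t, of "x j"] W[of x] jacobi_weight_nonneg[of N \<alpha>1 \<alpha>2 \<beta> x]
        by (cases "0 < x j \<and> x j < 1") auto
    qed
  qed (use j in \<open>auto simp: jacobi_flow_def\<close>)
  also have "\<dots> = enn2real (\<integral>\<^sup>+x. ennreal (?W x * x j ^ q) \<partial>?Q)"
    using j by (subst nn_integral_jacobi_weight_flow[OF t]) auto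
  also have "\<dots> = (\<integral>x. ?W x * x j ^ q \<partial>?Q)"
  proof (rule integral_eq_nn_integral[symmetric])
    show "AE x in ?Q. 0 \<le> ?W x * x j ^ q"
      using W jacobi_weight_nonneg[of N \<alpha>1 \<alpha>2 \<beta>]
      by (intro AE_I2) (metis less_imp_le mult_eq_0_iff mult_nonneg_nonneg zero_le_power order_refl)
  qed measurable
  finally show ?thesis
    by (simp add: integral_jacobi_ensemble)
qed

section \<open>Differentiation at time zero and the loop equation for one particle\<close>

lemma abs_ln_flow_le:
  assumes "\<bar>t\<bar> \<le> 1 / (2 * real (Suc p))" "\<bar>a\<bar> \<le> real (Suc p)"
  shows "\<bar>b * ln (1 + t * a)\<bar> \<le> \<bar>b\<bar> * (2 * real (Suc p)) * \<bar>t\<bar>"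
proof -
  have "\<bar>ln (1 + t * a)\<bar> \<le> 2 * \<bar>t * a\<bar>"
    by (rule abs_ln_one_plus_le[OF small_time_mult[OF assms]])
  also have "\<dots> \<le> 2 * (\<bar>t\<bar> * real (Suc p))"
    unfolding abs_mult using assms by (intro mult_left_mono) auto
  finally have "\<bar>b\<bar> * \<bar>ln (1 + t * a)\<bar> \<le> \<bar>b\<bar> * (2 * (\<bar>t\<bar> * real (Suc p)))"
    by (rule mult_left_mono) simp
  then show ?thesis by (simp add: abs_mult mult_ac)
qed

text \<open>There are finitely many summands, each bounded by \<open>abs_ln_flow_le\<close>. The
  constant may depend on \<open>N\<close>, because the derivative is taken at fixed
  \<open>N\<close>; only uniformity in \<open>t\<close> and \<open>x\<close> matters.\<close>

lemma jacobi_log_jacobian_bound: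
  obtains K where "\<And>t x. \<bar>t\<bar> \<le> 1 / (2 * real (Suc p)) \<Longrightarrow> x \<in> PiE {..<N} (\<lambda>_. {0<..<1}) \<Longrightarrow>
    \<bar>jacobi_log_jacobian p N \<alpha>1 \<alpha>2 \<beta> t x\<bar> \<le> K * \<bar>t\<bar>"
proof
  let ?c = "\<lambda>b. \<bar>b\<bar> * (2 * real (Suc p))"
  fix t :: real and x :: "nat \<Rightarrow> real"
  assume t: "\<bar>t\<bar> \<le> 1 / (2 * real (Suc p))" and x: "x \<in> PiE {..<N} (\<lambda>_. {0<..<1})"
  have x01: "0 \<le> x k" "x k \<le> 1" if "k < N" for k
    using PiE_mem[OF x, of k] that by auto
  have "\<bar>\<Sum>k<N. ln (1 + t * (1 - real (Suc p) * x k ^ p))\<bar> \<le> (\<Sum>k<N. ?c 1 * \<bar>t\<bar>)"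
  proof (intro order_trans[OF sum_abs] sum_mono)
    fix k assume "k \<in> {..<N}"
    then show "\<bar>ln (1 + t * (1 - real (Suc p) * x k ^ p))\<bar> \<le> ?c 1 * \<bar>t\<bar>"
      using abs_ln_flow_le[OF t, of _ 1] jacobi_rate_bounds[OF x01] by force
  qed
  moreover have "\<bar>\<Sum>k<N. \<alpha>1 * ln (1 + t * (1 - x k ^ p)) + \<alpha>2 * ln (1 + t * - (\<Sum>s = 1..p. x k ^ s))\<bar>
      \<le> (\<Sum>k<N. ?c \<alpha>1 * \<bar>t\<bar> + ?c \<alpha>2 * \<bar>t\<bar>)"
  proof (intro order_trans[OF sum_abs] sum_mono order_trans[OF abs_triangle_ineq] add_mono)
    fix k assume "k \<in> {..<N}"
    then have k: "k < N" by simp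
    show "\<bar>\<alpha>1 * ln (1 + t * (1 - x k ^ p))\<bar> \<le> ?c \<alpha>1 * \<bar>t\<bar>"
      "\<bar>\<alpha>2 * ln (1 + t * - (\<Sum>s = 1..p. x k ^ s))\<bar> \<le> ?c \<alpha>2 * \<bar>t\<bar>"
      by (intro abs_ln_flow_le t jacobi_rate_bounds x01 k)+
  qed
  moreover have "\<bar>\<Sum>k<N. \<Sum>j<k. \<beta> * ln (1 + t * (1 - (\<Sum>s\<le>p. x k ^ s * x j ^ (p - s))))\<bar>
      \<le> (\<Sum>k<N. \<Sum>j<k. ?c \<beta> * \<bar>t\<bar>)"
  proof (intro order_trans[OF sum_abs] sum_mono)
    fix k j assume "k \<in> {..<N}" "j \<in> {..<k}"
    then have "k < N" "j < N" by auto
    then show "\<bar>\<beta> * ln (1 + t * (1 - (\<Sum>s\<le>p. x k ^ s * x j ^ (p - s))))\<bar> \<le> ?c \<beta> * \<bar>t\<bar>"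
      by (intro abs_ln_flow_le t jacobi_pair_rate_bound x01)
  qed
  ultimately have "\<bar>jacobi_log_jacobian p N \<alpha>1 \<alpha>2 \<beta> t x\<bar> \<le>
      (\<Sum>k<N. ?c 1 * \<bar>t\<bar>) + (\<Sum>k<N. ?c \<alpha>1 * \<bar>t\<bar> + ?c \<alpha>2 * \<bar>t\<bar>) + (\<Sum>k<N. \<Sum>j<k. ?c \<beta> * \<bar>t\<bar>)"
    unfolding jacobi_log_jacobian_def by linarith
  then show "\<bar>jacobi_log_jacobian p N \<alpha>1 \<alpha>2 \<beta> t x\<bar> \<le>
      ((\<Sum>k<N. ?c 1) + (\<Sum>k<N. ?c \<alpha>1 + ?c \<alpha>2) + (\<Sum>k<N. \<Sum>j<k. ?c \<beta>)) * \<bar>t\<bar>"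
    by (simp only: distrib_right sum_distrib_right)
qed

lemma DERIV_ln_one_plus_mult: "((\<lambda>t. ln (1 + t * a)) has_real_derivative a) (at 0)"
  by (auto intro!: derivative_eq_intros)

lemma jacobi_log_jacobian_deriv:
  "((\<lambda>t. jacobi_log_jacobian p N \<alpha>1 \<alpha>2 \<beta> t x) has_real_derivative
     jacobi_loop_stat p N \<alpha>1 \<alpha>2 \<beta> x) (at 0)"
  unfolding jacobi_log_jacobian_def jacobi_loop_stat_def
  by (intro DERIV_add DERIV_sum DERIV_cmult DERIV_ln_one_plus_mult)

text \<open>Differentiating \<open>integral_jacobi_ensemble_flow\<close> at \<open>t = 0\<close>:
  the exponent contributes the loop statistic and the variation of \<open>x j ^ q\<close>
  itself.\<close>

lemma integral_loop_stat_particle: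
  assumes j: "j < N"
  shows "(\<integral>x. x j ^ q * (jacobi_loop_stat p N \<alpha>1 \<alpha>2 \<beta> x + real q * (1 - x j ^ p))
    \<partial>jacobi_ensemble N \<alpha>1 \<alpha>2 \<beta>) = 0"
proof -
  let ?M = "jacobi_ensemble N \<alpha>1 \<alpha>2 \<beta>"
  let ?\<epsilon> = "1 / (2 * real (Suc p))"
  have "(\<lambda>x. x j) \<in> measurable (PiM {..<N} (\<lambda>_. lborel :: real measure)) lborel"
    using j by (intro measurable_component_singleton) auto
  then have [measurable]: "(\<lambda>x. x j) \<in> borel_measurable (PiM {..<N} (\<lambda>_. lborel :: real measure))"
    by simp
  obtain K where K: "\<And>t x. \<bar>t\<bar> \<le> ?\<epsilon> \<Longrightarrow> x \<in> PiE {..<N} (\<lambda>_. {0<..<1}) \<Longrightarrow>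
      \<bar>jacobi_log_jacobian p N \<alpha>1 \<alpha>2 \<beta> t x\<bar> \<le> K * \<bar>t\<bar>"
    using jacobi_log_jacobian_bound[of p N \<alpha>1 \<alpha>2 \<beta>] by blast
  show ?thesis
  proof (rule integral_exp_variation_eq_0)
    show "finite_measure ?M" by (rule finite_measure_jacobi_ensemble)
    show "0 < ?\<epsilon>" by simp
    show "(\<lambda>x. x j ^ q) \<in> borel_measurable ?M"
      "(\<lambda>x. jacobi_loop_stat p N \<alpha>1 \<alpha>2 \<beta> x + real q * (1 - x j ^ p)) \<in> borel_measurable ?M"
      by measurable
    show "(\<lambda>x. jacobi_log_jacobian p N \<alpha>1 \<alpha>2 \<beta> t x + real q * ln (1 + t * (1 - x j ^ p)))
      \<in> borel_measurable ?M" for t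
      by measurable
    show "AE x in ?M. \<bar>x j ^ q\<bar> \<le> 1"
      using AE_jacobi_ensemble
    proof eventually_elim
      case (elim x)
      then show ?case using PiE_mem[OF elim, of j] j by (simp add: power_le_one)
    qed
    show "AE x in ?M. \<forall>t. \<bar>t\<bar> \<le> ?\<epsilon> \<longrightarrow>
      \<bar>jacobi_log_jacobian p N \<alpha>1 \<alpha>2 \<beta> t x + real q * ln (1 + t * (1 - x j ^ p))\<bar> \<le>
        (K + real q * (2 * real (Suc p))) * \<bar>t\<bar>"
      using AE_jacobi_ensemble
    proof eventually_elim
      case (elim x)
      have xj: "0 \<le> x j" "x j \<le> 1" using PiE_mem[OF elim, of j] j by auto
      show ?case
      proof (intro allI impI)
        fix t assume t: "\<bar>t\<bar> \<le> ?\<epsilon>"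
        show "\<bar>jacobi_log_jacobian p N \<alpha>1 \<alpha>2 \<beta> t x + real q * ln (1 + t * (1 - x j ^ p))\<bar> \<le>
          (K + real q * (2 * real (Suc p))) * \<bar>t\<bar>"
          using abs_ln_flow_le[OF t jacobi_rate_bounds(2)[OF xj], of "real q"] K[OF t elim]
          unfolding distrib_right abs_of_nat by linarith
      qed
    qed
    show "AE x in ?M. ((\<lambda>t. jacobi_log_jacobian p N \<alpha>1 \<alpha>2 \<beta> t x + real q * ln (1 + t * (1 - x j ^ p)))
      has_real_derivative jacobi_loop_stat p N \<alpha>1 \<alpha>2 \<beta> x + real q * (1 - x j ^ p)) (at 0)"
      by (intro AE_I2 DERIV_add jacobi_log_jacobian_deriv DERIV_cmult DERIV_ln_one_plus_mult)
    show "(\<integral>x. x j ^ q * exp (jacobi_log_jacobian p N \<alpha>1 \<alpha>2 \<beta> t x +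
        real q * ln (1 + t * (1 - x j ^ p))) \<partial>?M) = (\<integral>x. x j ^ q \<partial>?M)"
      if "0 < t" "t \<le> ?\<epsilon>" for t
      using that j by (intro integral_jacobi_ensemble_flow) auto
  qed
qed

section \<open>The loop statistic as a polynomial in power sums\<close>

lemma sum_below_diagonal:
  fixes f :: "nat \<Rightarrow> nat \<Rightarrow> real"
  shows "(\<Sum>k<N. \<Sum>j<N. f k j) = (\<Sum>k<N. \<Sum>j<k. f k j + f j k) + (\<Sum>k<N. f k k)"
  by (induction N) (simp_all add: sum.distrib algebra_simps)

text \<open>The product of power sums runs over all ordered pairs. Reflecting \<open>s\<close> to
  \<open>p - s\<close> shows that the two orders contribute equally, and each diagonal pair
  contributes \<open>p + 1\<close> copies of \<open>x k ^ p\<close>.\<close>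

lemma sum_pairs_eq_power_stat:
  "(\<Sum>k<N. \<Sum>j<k. \<Sum>s\<le>p. x k ^ s * x j ^ (p - s)) =
    ((\<Sum>s\<le>p. power_stat N s x * power_stat N (p - s) x) - real (Suc p) * power_stat N p x) / 2"
proof -
  have sym: "(\<Sum>s\<le>p. x j ^ s * x k ^ (p - s)) = (\<Sum>s\<le>p. x k ^ s * x j ^ (p - s))" for j k
    by (rule sum.reindex_bij_witness[of _ "\<lambda>s. p - s" "\<lambda>s. p - s"]) auto
  have diag: "(\<Sum>s\<le>p. x k ^ s * x k ^ (p - s)) = real (Suc p) * x k ^ p" for k
    by (simp flip: power_add)
  have "(\<Sum>s\<le>p. power_stat N s x * power_stat N (p - s) x) =
      (\<Sum>s\<le>p. \<Sum>k<N. \<Sum>j<N. x k ^ s * x j ^ (p - s))"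
    by (simp add: power_stat_def sum_product)
  also have "\<dots> = (\<Sum>k<N. \<Sum>s\<le>p. \<Sum>j<N. x k ^ s * x j ^ (p - s))"
    by (rule sum.swap)
  also have "\<dots> = (\<Sum>k<N. \<Sum>j<N. \<Sum>s\<le>p. x k ^ s * x j ^ (p - s))"
    by (intro sum.cong refl sum.swap)
  also have "\<dots> = 2 * (\<Sum>k<N. \<Sum>j<k. \<Sum>s\<le>p. x k ^ s * x j ^ (p - s)) +
      real (Suc p) * power_stat N p x"
    by (subst sum_below_diagonal)
       (simp add: sym[of _ "_ :: nat"] diag sum_distrib_left power_stat_def)
  finally show ?thesis by simp
qed

text \<open>Grouped into a constant, which drops out of covariances, single power sums, and products
  of two. The coefficient \<open>\<beta> / 2 * real (Suc p)\<close> is the diagonal correction from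
  \<open>sum_pairs_eq_power_stat\<close>; it disappears in the limit as \<open>\<beta>\<close> is of
  order 1/N.\<close>

lemma jacobi_loop_stat_eq:
  "jacobi_loop_stat p N \<alpha>1 \<alpha>2 \<beta> x =
    (real N * (1 + \<alpha>1) + \<beta> * real (\<Sum>k<N. k))
    + ((- (real (Suc p) + \<alpha>1) + \<beta> / 2 * real (Suc p)) * power_stat N p x
    + (\<Sum>s = 1..p. - \<alpha>2 * power_stat N s x)
    + (\<Sum>s\<le>p. - (\<beta> / 2) * (power_stat N s x * power_stat N (p - s) x)))"
proof -
  have 1: "(\<Sum>k<N. 1 - real (Suc p) * x k ^ p) = real N - real (Suc p) * power_stat N p x"
    by (simp only: sum_subtractf power_stat_def sum_distrib_left) simp
  have 2: "(\<Sum>k<N. \<alpha>1 * (1 - x k ^ p) + \<alpha>2 * - (\<Sum>s = 1..p. x k ^ s)) =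
      \<alpha>1 * (real N - power_stat N p x) - \<alpha>2 * (\<Sum>s = 1..p. power_stat N s x)"
    using sum.swap[of "\<lambda>k s. x k ^ s" "{1..p}" "{..<N}"]
    by (simp add: power_stat_def sum.distrib sum_subtractf sum_negf flip: sum_distrib_left)
  have 3: "(\<Sum>k<N. \<Sum>j<k. \<beta> * (1 - (\<Sum>s\<le>p. x k ^ s * x j ^ (p - s)))) =
      \<beta> * (real (\<Sum>k<N. k) - (\<Sum>k<N. \<Sum>j<k. \<Sum>s\<le>p. x k ^ s * x j ^ (p - s)))"
    by (simp add: sum_subtractf flip: sum_distrib_left)
  show ?thesis
    unfolding jacobi_loop_stat_def 1 2 3 sum_pairs_eq_power_stat
    by (simp add: algebra_simps sum_negf add_divide_distrib diff_divide_distrib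
        flip: sum_distrib_left sum_divide_distrib)
qed

section \<open>Cumulants and covariances\<close>

text \<open>A partition is determined by the block \<open>insert a B\<close> containing
  \<open>a\<close> and by the partition of the remaining points. This recursion enumerates the
  partitions of small sets explicitly.\<close>

lemma Collect_partition_on_insert:
  assumes "a \<notin> A"
  shows "{P. partition_on (insert a A) P} =
    (\<Union>B\<in>Pow A. insert (insert a B) ` {P. partition_on (A - B) P})" (is "?L = ?R")
proof (intro equalityI subsetI)
  fix P assume "P \<in> ?L"
  then have P: "partition_on (insert a A) P" by simp
  then obtain C where C: "C \<in> P" "a \<in> C"
    using partition_onD1[OF P] by auto
  have "disjnt C (\<Union>(P - {C}))"
    using partition_onD2[OF P] C(1) by (auto simp: disjoint_def disjnt_def)
  then have "partition_on (insert a A - C) (P - {C})" "C \<subseteq> insert a A"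
    using partition_on_insert[of C "P - {C}"] P C(1) by (auto simp: insert_absorb)
  moreover have "insert a (C - {a}) = C" "insert a A - C = A - (C - {a})"
    using C(2) assms by auto
  ultimately show "P \<in> ?R"
    using C by (auto intro!: bexI[of _ "C - {a}"] image_eqI[of _ _ "P - {C}"])
next
  fix P assume "P \<in> ?R"
  then obtain B P' where B: "B \<subseteq> A" "partition_on (A - B) P'" "P = insert (insert a B) P'"
    by auto
  have "disjnt (insert a B) (\<Union>P')" "insert a A - insert a B = A - B"
    using partition_onD1[OF B(2)] assms by (auto simp: disjnt_def)
  then show "P \<in> ?L"
    using B partition_on_insert[of "insert a B" P' "insert a A"] by auto
qed

lemma Collect_partition_on_empty: "{P. partition_on {} P} = {{}}"
  by (simp add: partition_on_empty)

lemma Collect_partition_on_1: "{P. partition_on {a} P} = {{{a}}}"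
  using Collect_partition_on_insert[of a "{}"] by (simp add: Collect_partition_on_empty)

lemma Collect_partition_on_2:
  "a \<noteq> b \<Longrightarrow> {P. partition_on {a, b} P} = {{{a}, {b}}, {{a, b}}}"
  using Collect_partition_on_insert[of a "{b}"]
  by (simp add: Pow_insert Collect_partition_on_empty Collect_partition_on_1)

lemma Collect_partition_on_3:
  assumes "a \<noteq> b" "a \<noteq> c" "b \<noteq> c"
  shows "{P. partition_on {a, b, c} P} =
    {{{a}, {b}, {c}}, {{a}, {b, c}}, {{a, b}, {c}}, {{a, c}, {b}}, {{a, b, c}}}"
proof -
  have "{b, c} - {c} = {b}" "{b, c} - {b} = {c}" using assms by auto
  then show ?thesis
    using Collect_partition_on_insert[of a "{b, c}"] assms
    by (simp add: Pow_insert Collect_partition_on_empty Collect_partition_on_1 Collect_partition_on_2)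
       (auto simp: insert_commute)
qed

section \<open>Cumulants up to order three in terms of moments\<close>

lemma joint_cumulant_1:
  fixes X :: "nat \<Rightarrow> 'a \<Rightarrow> real"
  shows "joint_cumulant M {1..1} X = (\<integral>\<omega>. X 1 \<omega> \<partial>M)"
  unfolding joint_cumulant_def by (simp add: Collect_partition_on_1)

lemma joint_cumulant_2:
  fixes X :: "nat \<Rightarrow> 'a \<Rightarrow> real"
  shows "joint_cumulant M {1..2} X =
    (\<integral>\<omega>. X 1 \<omega> * X 2 \<omega> \<partial>M) - (\<integral>\<omega>. X 1 \<omega> \<partial>M) * (\<integral>\<omega>. X 2 \<omega> \<partial>M)"
proof -
  have I: "{1..2::nat} = {1, 2}" by auto
  have neq: "{{1::nat}, {2}} \<noteq> {{1, 2}}" "{1::nat} \<noteq> {2}" by auto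
  show ?thesis
    unfolding joint_cumulant_def I using neq by (simp add: Collect_partition_on_2)
qed

lemma joint_cumulant_3:
  fixes X :: "nat \<Rightarrow> 'a \<Rightarrow> real"
  shows "joint_cumulant M {1..3} X =
    (\<integral>\<omega>. X 1 \<omega> * X 2 \<omega> * X 3 \<omega> \<partial>M)
    - (\<integral>\<omega>. X 1 \<omega> \<partial>M) * (\<integral>\<omega>. X 2 \<omega> * X 3 \<omega> \<partial>M)
    - (\<integral>\<omega>. X 2 \<omega> \<partial>M) * (\<integral>\<omega>. X 1 \<omega> * X 3 \<omega> \<partial>M)
    - (\<integral>\<omega>. X 3 \<omega> \<partial>M) * (\<integral>\<omega>. X 1 \<omega> * X 2 \<omega> \<partial>M)
    + 2 * (\<integral>\<omega>. X 1 \<omega> \<partial>M) * (\<integral>\<omega>. X 2 \<omega> \<partial>M) * (\<integral>\<omega>. X 3 \<omega> \<partial>M)"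
proof -
  have I: "{1..3::nat} = {1, 2, 3}" by auto
  let ?P1 = "{{1}, {2}, {3}} :: nat set set" and ?P2 = "{{1}, {2, 3}} :: nat set set"
    and ?P3 = "{{1, 2}, {3}} :: nat set set" and ?P4 = "{{1, 3}, {2}} :: nat set set"
    and ?P5 = "{{1, 2, 3}} :: nat set set"
  have block: "{1::nat} \<noteq> {2}" "{1::nat} \<noteq> {3}" "{2::nat} \<noteq> {3}" "{1::nat} \<noteq> {2, 3}"
    "{1, 2::nat} \<noteq> {3}" "{1, 3::nat} \<noteq> {2}" "{2, 3::nat} \<noteq> {1}" "{3::nat} \<noteq> {1, 2}" "{2::nat} \<noteq> {1, 3}"
    by auto
  have card: "card ?P1 = 3" "card ?P2 = 2" "card ?P3 = 2" "card ?P4 = 2" "card ?P5 = 1"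
    using block by auto
  \<comment> \<open>Two of the five partitions are told apart by a block that belongs to only one of
    them.\<close>
  have "{1::nat} \<notin> ?P3" "{1::nat} \<notin> ?P4" "{1::nat} \<notin> ?P5" "{1, 2::nat} \<notin> ?P4" "{1, 2::nat} \<notin> ?P5"
    "{2, 3::nat} \<notin> ?P1" "{1, 3::nat} \<notin> ?P5"
    by auto
  then have neq: "?P1 \<noteq> ?P2" "?P1 \<noteq> ?P3" "?P1 \<noteq> ?P4" "?P1 \<noteq> ?P5" "?P2 \<noteq> ?P3" "?P2 \<noteq> ?P4"
    "?P2 \<noteq> ?P5" "?P3 \<noteq> ?P4" "?P3 \<noteq> ?P5" "?P4 \<noteq> ?P5"
    by (metis insertI1 insertI2)+
  define T where "T P = (-1) ^ (card P - 1) * fact (card P - 1) *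
    (\<Prod>B\<in>P. \<integral>\<omega>. (\<Prod>i\<in>B. X i \<omega>) \<partial>M)" for P :: "nat set set"
  have "joint_cumulant M {1..3} X = sum T {?P1, ?P2, ?P3, ?P4, ?P5}"
    unfolding joint_cumulant_def I T_def by (subst Collect_partition_on_3) auto
  also have "\<dots> = T ?P1 + T ?P2 + T ?P3 + T ?P4 + T ?P5"
    using neq by simp
  finally show ?thesis
    unfolding T_def card using block by (simp add: mult_ac fact_numeral)
qed

text \<open>The ensemble is concentrated on the unit cube, so its statistics are bounded almost
  everywhere though not on all configurations. The property is stable under sums and products and
  gives integrability for finite measures.\<close>

definition ess_bounded :: "'a measure \<Rightarrow> ('a \<Rightarrow> real) \<Rightarrow> bool" where
  "ess_bounded M X \<longleftrightarrow> X \<in> borel_measurable M \<and> (\<exists>B. AE x in M. \<bar>X x\<bar> \<le> B)"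

lemma ess_bounded_const: "ess_bounded M (\<lambda>_. c)"
  unfolding ess_bounded_def by auto

lemma ess_bounded_add:
  assumes "ess_bounded M X" "ess_bounded M Y"
  shows "ess_bounded M (\<lambda>x. X x + Y x)"
proof -
  obtain A B where "AE x in M. \<bar>X x\<bar> \<le> A" "AE x in M. \<bar>Y x\<bar> \<le> B"
    using assms unfolding ess_bounded_def by auto
  then have "AE x in M. \<bar>X x + Y x\<bar> \<le> A + B"
    by eventually_elim auto
  then show ?thesis using assms unfolding ess_bounded_def by auto
qed

lemma ess_bounded_mult:
  assumes "ess_bounded M X" "ess_bounded M Y"
  shows "ess_bounded M (\<lambda>x. X x * Y x)"
proof -
  obtain A B where "AE x in M. \<bar>X x\<bar> \<le> A" "AE x in M. \<bar>Y x\<bar> \<le> B"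
    using assms unfolding ess_bounded_def by auto
  then have "AE x in M. \<bar>X x * Y x\<bar> \<le> A * B"
    by eventually_elim (auto simp: abs_mult intro!: mult_mono)
  then show ?thesis using assms unfolding ess_bounded_def by auto
qed

lemma ess_bounded_diff:
  assumes "ess_bounded M X" "ess_bounded M Y"
  shows "ess_bounded M (\<lambda>x. X x - Y x)"
  using ess_bounded_add[OF assms(1) ess_bounded_mult[OF ess_bounded_const[of M "-1"] assms(2)]]
  by simp

lemma ess_bounded_sum:
  "(\<And>i. i \<in> I \<Longrightarrow> ess_bounded M (X i)) \<Longrightarrow> ess_bounded M (\<lambda>x. \<Sum>i\<in>I. X i x)"
  by (induction I rule: infinite_finite_induct) (auto intro: ess_bounded_const ess_bounded_add)

lemma (in finite_measure) integrable_ess_bounded: "ess_bounded M X \<Longrightarrow> integrable M X"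
  unfolding ess_bounded_def using integrable_const_bound[of X] by auto

section \<open>Bilinearity of the covariance and its third-order expansion\<close>

context prob_space
begin

lemma covariance_eq:
  assumes "ess_bounded M X" "ess_bounded M Y"
  shows "covariance M X Y = (\<integral>x. X x * Y x \<partial>M) - (\<integral>x. X x \<partial>M) * (\<integral>x. Y x \<partial>M)"
proof -
  note [simp] = assms[THEN integrable_ess_bounded]
    integrable_ess_bounded[OF ess_bounded_mult[OF assms]]
  show ?thesis
    unfolding covariance_def by (simp add: algebra_simps prob_space)
qed

lemma covariance_const: "ess_bounded M Y \<Longrightarrow> covariance M (\<lambda>_. c) Y = 0"
  by (simp add: covariance_def prob_space)

lemma covariance_cmult:
  assumes "ess_bounded M X" "ess_bounded M Y"
  shows "covariance M (\<lambda>x. c * X x) Y = c * covariance M X Y"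
  using assms
  by (simp add: covariance_eq ess_bounded_mult ess_bounded_const mult.assoc right_diff_distrib)

lemma covariance_add:
  assumes "ess_bounded M X" "ess_bounded M X'" "ess_bounded M Y"
  shows "covariance M (\<lambda>x. X x + X' x) Y = covariance M X Y + covariance M X' Y"
proof -
  note [simp] = assms[THEN integrable_ess_bounded]
    integrable_ess_bounded[OF ess_bounded_mult[OF assms(1,3)]]
    integrable_ess_bounded[OF ess_bounded_mult[OF assms(2,3)]]
  show ?thesis
    using assms by (simp add: covariance_eq ess_bounded_add algebra_simps)
qed

lemma covariance_sum:
  assumes "\<And>i. i \<in> I \<Longrightarrow> ess_bounded M (X i)" "ess_bounded M Y"
  shows "covariance M (\<lambda>x. \<Sum>i\<in>I. X i x) Y = (\<Sum>i\<in>I. covariance M (X i) Y)"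
  using assms
  by (induction I rule: infinite_finite_induct)
     (auto simp: covariance_const covariance_add ess_bounded_sum)

text \<open>The formula for the third cumulant, rearranged. It separates the orders in
  \<open>N\<close>: under the ansatz the cumulant is \<open>O(N)\<close>, whereas a mean times a
  covariance is \<open>O(N^2)\<close>.\<close>

lemma covariance_mult_left:
  fixes Z :: "nat \<Rightarrow> 'a \<Rightarrow> real"
  assumes "\<And>i. ess_bounded M (Z i)"
  shows "covariance M (\<lambda>x. Z 1 x * Z 2 x) (Z 3) =
    joint_cumulant M {1..3} Z + (\<integral>x. Z 1 x \<partial>M) * covariance M (Z 2) (Z 3)
    + (\<integral>x. Z 2 x \<partial>M) * covariance M (Z 1) (Z 3)"
  unfolding joint_cumulant_3 using assms
  by (simp add: covariance_eq ess_bounded_mult algebra_simps)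

end

section \<open>The loop equation\<close>

lemma covariance_null_measure: "covariance (null_measure M) X Y = 0"
  by (simp add: covariance_def)

lemma joint_cumulant_null_measure_3:
  "joint_cumulant (null_measure M) {1..3::nat} X = 0"
  by (subst joint_cumulant_3) simp

lemma particle_power_ess_bounded:
  assumes j: "j < N"
  shows "ess_bounded (jacobi_ensemble N \<alpha>1 \<alpha>2 \<beta>) (\<lambda>x. x j ^ p)"
proof -
  have "AE x in jacobi_ensemble N \<alpha>1 \<alpha>2 \<beta>. \<bar>x j ^ p\<bar> \<le> 1"
    using AE_jacobi_ensemble
  proof eventually_elim
    case (elim x)
    then show ?case using PiE_mem[OF elim, of j] j by (simp add: power_le_one)
  qed
  moreover have "(\<lambda>x. x j) \<in> measurable (PiM {..<N} (\<lambda>_. lborel :: real measure)) lborel"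
    using j by (intro measurable_component_singleton) simp
  then have "(\<lambda>x. x j ^ p) \<in> borel_measurable (jacobi_ensemble N \<alpha>1 \<alpha>2 \<beta>)"
    by (intro borel_measurable_power) (simp cong: measurable_cong_sets add: sets_jacobi_ensemble)
  ultimately show ?thesis
    unfolding ess_bounded_def by blast
qed

lemma power_stat_ess_bounded: "ess_bounded (jacobi_ensemble N \<alpha>1 \<alpha>2 \<beta>) (power_stat N p)"
  unfolding power_stat_def by (intro ess_bounded_sum particle_power_ess_bounded) simp

lemma power_stat_0: "power_stat N 0 x = real N"
  by (simp add: power_stat_def)

lemma loop_stat_ess_bounded:
  "ess_bounded (jacobi_ensemble N \<alpha>1 \<alpha>2 \<beta>) (jacobi_loop_stat p N \<alpha>1 \<alpha>2 \<beta>)"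
  unfolding jacobi_loop_stat_eq[abs_def]
  by (intro ess_bounded_add ess_bounded_sum ess_bounded_mult ess_bounded_const
      power_stat_ess_bounded)

text \<open>The loop equation for one particle is summed over all particles. Since the loop
  statistic has mean 0, its mixed moment with a power sum is a covariance.\<close>

lemma covariance_loop_stat:
  assumes "N \<ge> 1"
  shows "covariance (jacobi_ensemble N \<alpha>1 \<alpha>2 \<beta>) (jacobi_loop_stat p N \<alpha>1 \<alpha>2 \<beta>) (power_stat N q) =
    real q * ((\<integral>x. power_stat N (p + q) x \<partial>jacobi_ensemble N \<alpha>1 \<alpha>2 \<beta>)
      - (\<integral>x. power_stat N q x \<partial>jacobi_ensemble N \<alpha>1 \<alpha>2 \<beta>))"
proof (cases rule: jacobi_ensemble_cases[of N \<alpha>1 \<alpha>2 \<beta>])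
  case 1
  then show ?thesis by (simp add: covariance_null_measure)
next
  case 2
  let ?M = "jacobi_ensemble N \<alpha>1 \<alpha>2 \<beta>"
  let ?D = "jacobi_loop_stat p N \<alpha>1 \<alpha>2 \<beta>"
  interpret prob_space ?M by (rule 2)
  have mean: "(\<integral>x. ?D x \<partial>?M) = 0"
    \<comment> \<open>The exponent 0 leaves the bare loop statistic; particle 0 exists because
      \<open>N \<ge> 1\<close>.\<close>
    using integral_loop_stat_particle[where j = 0 and q = 0] assms by simp
  have [simp]: "integrable ?M (power_stat N s)" "integrable ?M (\<lambda>x. ?D x * power_stat N s x)" for s
    by (intro integrable_ess_bounded ess_bounded_mult power_stat_ess_bounded loop_stat_ess_bounded)+
  have int_j: "integrable ?M (\<lambda>x. x j ^ q * (?D x + real q * (1 - x j ^ p)))" if "j < N" for j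
    using that by (intro integrable_ess_bounded ess_bounded_mult ess_bounded_add ess_bounded_diff
        ess_bounded_const particle_power_ess_bounded loop_stat_ess_bounded)
  have "(\<Sum>j<N. x j ^ q * (?D x + real q * (1 - x j ^ p))) =
      ?D x * power_stat N q x + real q * (power_stat N q x - power_stat N (p + q) x)" for x
    by (simp add: power_stat_def sum_distrib_left sum.distrib sum_subtractf algebra_simps power_add)
  then have "(\<integral>x. ?D x * power_stat N q x + real q * (power_stat N q x - power_stat N (p + q) x) \<partial>?M) =
      (\<Sum>j<N. \<integral>x. x j ^ q * (?D x + real q * (1 - x j ^ p)) \<partial>?M)"
    using int_j by (subst Bochner_Integration.integral_sum[symmetric]) auto
  also have "\<dots> = 0"
    using integral_loop_stat_particle by simp
  finally have "(\<integral>x. ?D x * power_stat N q x \<partial>?M) + real q * ((\<integral>x. power_stat N q x \<partial>?M)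
      - (\<integral>x. power_stat N (p + q) x \<partial>?M)) = 0"
    by simp
  then have "(\<integral>x. ?D x * power_stat N q x \<partial>?M) =
      real q * ((\<integral>x. power_stat N (p + q) x \<partial>?M) - (\<integral>x. power_stat N q x \<partial>?M))"
    by (simp add: algebra_simps)
  then show ?thesis
    by (simp add: covariance_eq loop_stat_ess_bounded power_stat_ess_bounded mean)
qed

lemma covariance_loop_stat_expand:
  "covariance (jacobi_ensemble N \<alpha>1 \<alpha>2 \<beta>) (jacobi_loop_stat p N \<alpha>1 \<alpha>2 \<beta>) (power_stat N q) =
    (- (real (Suc p) + \<alpha>1) + \<beta> / 2 * real (Suc p)) *
      covariance (jacobi_ensemble N \<alpha>1 \<alpha>2 \<beta>) (power_stat N p) (power_stat N q)
    - \<alpha>2 * (\<Sum>s = 1..p. covariance (jacobi_ensemble N \<alpha>1 \<alpha>2 \<beta>) (power_stat N s) (power_stat N q))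
    - \<beta> / 2 * (\<Sum>s\<le>p. covariance (jacobi_ensemble N \<alpha>1 \<alpha>2 \<beta>)
        (\<lambda>x. power_stat N s x * power_stat N (p - s) x) (power_stat N q))"
proof (cases rule: jacobi_ensemble_cases[of N \<alpha>1 \<alpha>2 \<beta>])
  case 1
  then show ?thesis by (simp add: covariance_null_measure)
next
  case 2
  interpret prob_space "jacobi_ensemble N \<alpha>1 \<alpha>2 \<beta>" by (rule 2)
  note bounded = ess_bounded_add ess_bounded_sum ess_bounded_mult ess_bounded_const
      power_stat_ess_bounded
  show ?thesis
    unfolding jacobi_loop_stat_eq[abs_def]
    by (simp only: covariance_add covariance_sum covariance_cmult covariance_const bounded
        sum_distrib_left[symmetric]) simp
qed

text \<open>The update \<open>(\<lambda>_. q)(1 := r, 2 := s)\<close> places \<open>r\<close>,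
  \<open>s\<close>, \<open>q\<close> at the indices 1, 2, 3, which is the form in which the ansatz
  receives exponents.\<close>

lemma covariance_power_stat_mult:
  "covariance (jacobi_ensemble N \<alpha>1 \<alpha>2 \<beta>) (\<lambda>x. power_stat N r x * power_stat N s x) (power_stat N q) =
    joint_cumulant (jacobi_ensemble N \<alpha>1 \<alpha>2 \<beta>) {1..3} (\<lambda>i::nat. power_stat N (((\<lambda>_. q)(1 := r, 2 := s)) i))
    + (\<integral>x. power_stat N r x \<partial>jacobi_ensemble N \<alpha>1 \<alpha>2 \<beta>) *
        covariance (jacobi_ensemble N \<alpha>1 \<alpha>2 \<beta>) (power_stat N s) (power_stat N q)
    + (\<integral>x. power_stat N s x \<partial>jacobi_ensemble N \<alpha>1 \<alpha>2 \<beta>) *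
        covariance (jacobi_ensemble N \<alpha>1 \<alpha>2 \<beta>) (power_stat N r) (power_stat N q)"
proof (cases rule: jacobi_ensemble_cases[of N \<alpha>1 \<alpha>2 \<beta>])
  case 1
  then show ?thesis
    by (simp only: covariance_null_measure joint_cumulant_null_measure_3 integral_null_measure mult_zero_right add_0)
next
  case 2
  interpret prob_space "jacobi_ensemble N \<alpha>1 \<alpha>2 \<beta>" by (rule 2)
  show ?thesis
    using covariance_mult_left[of "\<lambda>i::nat. power_stat N (((\<lambda>_. q)(1 := r, 2 := s)) i)"]
      power_stat_ess_bounded by simp
qed

section \<open>The limit of large \<open>N\<close>\<close>

text \<open>The case \<open>L = 0\<close> of the expansion: after subtracting the leading term the
  remainder is \<open>o(N)\<close>.\<close>

lemma has_large_N_expansion_leading: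
  assumes "has_large_N_expansion f c"
  shows "(\<lambda>N. f N / real N) \<longlonglongrightarrow> c 0"
proof -
  have "(\<lambda>N. f N - real N * c 0) \<in> o(\<lambda>N. real N)"
    using assms[unfolded has_large_N_expansion_def, rule_format, of 0] by simp
  then have "(\<lambda>N. (f N - real N * c 0) / real N) \<longlonglongrightarrow> 0"
    by (rule smalloD_tendsto)
  then have "(\<lambda>N. (f N - real N * c 0) / real N + c 0) \<longlonglongrightarrow> c 0"
    using tendsto_add[OF _ tendsto_const[of "c 0"]] by fastforce
  then show ?thesis
    by (rule Lim_transform_eventually)
       (auto intro!: eventually_mono[OF eventually_gt_at_top[of 0]] simp: field_simps)
qed

lemma jacobi_ensemble_covariance_eq_cumulant:
  "covariance (jacobi_ensemble N \<alpha>1 \<alpha>2 \<beta>) (power_stat N p) (power_stat N q) =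
    joint_cumulant (jacobi_ensemble N \<alpha>1 \<alpha>2 \<beta>) {1..2} (\<lambda>i::nat. power_stat N (((\<lambda>_. q)(1 := p)) i))"
proof (cases rule: jacobi_ensemble_cases[of N \<alpha>1 \<alpha>2 \<beta>])
  case 1
  then show ?thesis by (simp only: covariance_null_measure joint_cumulant_2) simp
next
  case 2
  interpret prob_space "jacobi_ensemble N \<alpha>1 \<alpha>2 \<beta>" by (rule 2)
  show ?thesis
    unfolding joint_cumulant_2 by (simp add: covariance_eq power_stat_ess_bounded)
qed

lemma jacobi_cumulant_lim:
  fixes p :: "nat \<Rightarrow> nat"
  assumes "jacobi_large_N_ansatz \<alpha>1 \<alpha>2 \<alpha>" "n \<ge> 1"
  obtains l where "(\<lambda>N. joint_cumulant (jacobi_high_temp \<alpha>1 \<alpha>2 \<alpha> N) {1..n}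
    (\<lambda>i. power_stat N (p i)) / real N) \<longlonglongrightarrow> l"
proof -
  obtain c where "has_large_N_expansion (\<lambda>N. joint_cumulant (jacobi_high_temp \<alpha>1 \<alpha>2 \<alpha> N) {1..n}
      (\<lambda>i. power_stat N (p i))) c"
    using assms unfolding jacobi_large_N_ansatz_def by blast
  from that[OF has_large_N_expansion_leading[OF this]] show ?thesis .
qed

text \<open>The ansatz for \<open>n = 1\<close> gives convergence, so the \<open>lim\<close> in the
  definition denotes a genuine limit.\<close>

lemma jacobi_moment_lim:
  assumes "jacobi_large_N_ansatz \<alpha>1 \<alpha>2 \<alpha>"
  shows "(\<lambda>N. (\<integral>x. power_stat N p x \<partial>jacobi_high_temp \<alpha>1 \<alpha>2 \<alpha> N) / real N)
    \<longlonglongrightarrow> jacobi_moment_lim \<alpha>1 \<alpha>2 \<alpha> p"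
proof -
  obtain l where l: "(\<lambda>N. (\<integral>x. power_stat N p x \<partial>jacobi_high_temp \<alpha>1 \<alpha>2 \<alpha> N) / real N) \<longlonglongrightarrow> l"
    using jacobi_cumulant_lim[OF assms, where n = 1 and p = "\<lambda>_. p"] unfolding joint_cumulant_1 by auto
  then show ?thesis
    using limI[OF l] by (simp add: jacobi_moment_lim_def)
qed

lemma jacobi_cov_lim:
  assumes "jacobi_large_N_ansatz \<alpha>1 \<alpha>2 \<alpha>"
  shows "(\<lambda>N. covariance (jacobi_high_temp \<alpha>1 \<alpha>2 \<alpha> N) (power_stat N p) (power_stat N q) / real N)
    \<longlonglongrightarrow> jacobi_cov_lim \<alpha>1 \<alpha>2 \<alpha> p q"
proof -
  obtain l where l: "(\<lambda>N. covariance (jacobi_high_temp \<alpha>1 \<alpha>2 \<alpha> N) (power_stat N p) (power_stat N q)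
      / real N) \<longlonglongrightarrow> l"
    using jacobi_cumulant_lim[OF assms, where n = 2 and p = "(\<lambda>_. q)(1 := p)"]
    unfolding jacobi_high_temp_def jacobi_ensemble_covariance_eq_cumulant by (metis one_le_numeral)
  then show ?thesis
    using limI[OF l] by (simp add: jacobi_cov_lim_def)
qed

theorem mainTheorem8:
  fixes \<alpha> \<alpha>1 \<alpha>2 :: real and p q :: nat
  assumes "\<alpha>1 > -1" and "\<alpha>2 > -1"
    and "\<alpha> > - Min {1, 1 + \<alpha>1, 1 + \<alpha>2}"
    and "jacobi_large_N_ansatz \<alpha>1 \<alpha>2 \<alpha>"
    and "p \<ge> 1" and "q \<ge> 1"
  defines "m \<equiv> jacobi_moment_lim \<alpha>1 \<alpha>2 \<alpha>"
    and "\<mu> \<equiv> jacobi_cov_lim \<alpha>1 \<alpha>2 \<alpha>"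
  shows "\<mu> p q =
    1 / (real p + \<alpha>1 + \<alpha>2 + 2 * \<alpha> + 1) *
      (real q * (m q - m (p + q))
       - \<alpha>2 * (\<Sum>s = 1..p - 1. \<mu> s q)
       - 2 * \<alpha> * (\<Sum>s = 1..p - 1. m s * \<mu> (p - s) q))"
proof -
  note ansatz = \<open>jacobi_large_N_ansatz \<alpha>1 \<alpha>2 \<alpha>\<close>
  define M where "M = jacobi_high_temp \<alpha>1 \<alpha>2 \<alpha>"
  define E where "E s N = (\<integral>x. power_stat N s x \<partial>M N) / real N" for s N
  define C where "C s N = covariance (M N) (power_stat N s) (power_stat N q) / real N" for s N
  define \<kappa> where "\<kappa> s N = joint_cumulant (M N) {1..3}
    (\<lambda>i::nat. power_stat N (((\<lambda>_. q)(1 := s, 2 := p - s)) i)) / real N" for s N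
  have E: "E s \<longlonglongrightarrow> m s" for s
    using jacobi_moment_lim[OF ansatz] unfolding E_def M_def m_def .
  have C: "C s \<longlonglongrightarrow> \<mu> s q" for s
    using jacobi_cov_lim[OF ansatz] unfolding C_def M_def \<mu>_def .
  have \<kappa>: "(\<lambda>N. \<kappa> s N / real N) \<longlonglongrightarrow> 0" for s
  proof -
    obtain l where "\<kappa> s \<longlonglongrightarrow> l"
      using jacobi_cumulant_lim[OF ansatz, where n = 3 and p = "(\<lambda>_. q)(1 := s, 2 := p - s)"]
      unfolding \<kappa>_def[abs_def] M_def by (metis one_le_numeral)
    from tendsto_mult[OF this lim_1_over_n] show ?thesis by simp
  qed
  \<comment> \<open>The two evaluations of the covariance of the loop statistic with
    \<open>power_stat N q\<close> are equated and divided by \<open>N\<close>. Means and covariances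
    are \<open>N\<close> times \<open>E\<close> and \<open>C\<close>, so the coefficient
    \<open>\<alpha> / N\<close> of their products becomes \<open>\<alpha>\<close>, while the third
    cumulant keeps an additional factor 1/N.\<close>
  have loop: "(- (real (Suc p) + \<alpha>1) + \<alpha> * (1 / real N) * real (Suc p)) * C p N
      - \<alpha>2 * (\<Sum>s = 1..p. C s N)
      - \<alpha> * (\<Sum>s\<le>p. \<kappa> s N / real N + E s N * C (p - s) N + E (p - s) N * C s N) =
      real q * (E (p + q) N - E q N)" if N: "N \<ge> 1" for N
  proof -
    define cov where "cov s = covariance (M N) (power_stat N s) (power_stat N q)" for s
    have "(- (real (Suc p) + \<alpha>1) + \<alpha> / real N * real (Suc p)) * cov p
        - \<alpha>2 * (\<Sum>s = 1..p. cov s)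
        - \<alpha> / real N * (\<Sum>s\<le>p. real N * \<kappa> s N + real N * E s N * cov (p - s) + real N * E (p - s) N * cov s) =
      real q * (real N * E (p + q) N - real N * E q N)"
      using covariance_loop_stat[OF N, of \<alpha>1 \<alpha>2 "2 * \<alpha> / real N" p q] N
      unfolding covariance_loop_stat_expand covariance_power_stat_mult
      by (simp add: M_def jacobi_high_temp_def E_def \<kappa>_def cov_def)
    moreover have cov: "cov s = real N * C s N" for s
      using N by (simp add: cov_def C_def)
    moreover have "real N * \<kappa> s N + real N * E s N * cov (p - s) + real N * E (p - s) N * cov s =
        real N * real N * (\<kappa> s N / real N + E s N * C (p - s) N + E (p - s) N * C s N)" for s
      using N unfolding cov by (simp add: algebra_simps)
    ultimately have scaled: "(- (real (Suc p) + \<alpha>1) + \<alpha> / real N * real (Suc p)) * (real N * C p N)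
        - \<alpha>2 * (real N * (\<Sum>s = 1..p. C s N))
        - \<alpha> / real N * (real N * real N *
            (\<Sum>s\<le>p. \<kappa> s N / real N + E s N * C (p - s) N + E (p - s) N * C s N)) =
      real q * (real N * E (p + q) N - real N * E q N)"
      by (simp only: sum_distrib_left)
    \<comment> \<open>Cancelling the common factor \<open>n\<close> is isolated for free real
      variables, so that only a polynomial identity remains.\<close>
    have cancel: "A * c - a * s - b * u = d * (e - f)"
      if "A * (n * c) - a * (n * s) - b / n * (n * n * u) = d * (n * e - n * f)" "n > 0"
      for A a b c d e f n s u :: real
    proof -
      have "n * (A * c - a * s - b * u) = n * (d * (e - f))"
        using that by (simp add: algebra_simps)
      then show ?thesis using \<open>n > 0\<close> by simp
    qed
    show ?thesis
      using cancel[OF scaled] N by simp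
  qed
  have lim_lhs: "(\<lambda>N. (- (real (Suc p) + \<alpha>1) + \<alpha> * (1 / real N) * real (Suc p)) * C p N
      - \<alpha>2 * (\<Sum>s = 1..p. C s N)
      - \<alpha> * (\<Sum>s\<le>p. \<kappa> s N / real N + E s N * C (p - s) N + E (p - s) N * C s N))
    \<longlonglongrightarrow> (- (real (Suc p) + \<alpha>1) + \<alpha> * 0 * real (Suc p)) * \<mu> p q
      - \<alpha>2 * (\<Sum>s = 1..p. \<mu> s q)
      - \<alpha> * (\<Sum>s\<le>p. 0 + m s * \<mu> (p - s) q + m (p - s) * \<mu> s q)"
    by (intro tendsto_intros E C \<kappa> lim_1_over_n)
  have lim_rhs: "(\<lambda>N. real q * (E (p + q) N - E q N)) \<longlonglongrightarrow> real q * (m (p + q) - m q)"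
    by (intro tendsto_intros E)
  have limit_eq: "(- (real (Suc p) + \<alpha>1) + \<alpha> * 0 * real (Suc p)) * \<mu> p q
      - \<alpha>2 * (\<Sum>s = 1..p. \<mu> s q)
      - \<alpha> * (\<Sum>s\<le>p. 0 + m s * \<mu> (p - s) q + m (p - s) * \<mu> s q) = real q * (m (p + q) - m q)"
  proof (rule tendsto_unique[OF sequentially_bot lim_lhs Lim_transform_eventually[OF lim_rhs]])
    show "\<forall>\<^sub>F N in sequentially. real q * (E (p + q) N - E q N) =
      (- (real (Suc p) + \<alpha>1) + \<alpha> * (1 / real N) * real (Suc p)) * C p N
      - \<alpha>2 * (\<Sum>s = 1..p. C s N)
      - \<alpha> * (\<Sum>s\<le>p. \<kappa> s N / real N + E s N * C (p - s) N + E (p - s) N * C s N)"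
      using eventually_ge_at_top[of 1] by eventually_elim (rule loop[symmetric])
  qed
  \<comment> \<open>For the null measure \<open>E 0 N\<close> is \<open>0\<close> instead of \<open>1\<close>, but then \<open>C p N = 0\<close> as well.\<close>
  have "C 0 N = 0 \<and> E 0 N * C p N = C p N" if "N \<ge> 1" for N
  proof (cases rule: jacobi_ensemble_cases[of N \<alpha>1 \<alpha>2 "2 * \<alpha> / real N"])
    case 1
    then show ?thesis by (simp add: C_def M_def jacobi_high_temp_def covariance_null_measure)
  next
    case 2
    then interpret prob_space "M N" by (simp add: M_def jacobi_high_temp_def)
    show ?thesis
      using that by (simp add: C_def E_def covariance_def power_stat_0[abs_def] prob_space)
  qed
  then have order0: "C 0 N = 0" "E 0 N * C p N = C p N" if "N \<ge> 1" for N
    using that by auto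
  have "\<mu> 0 q = 0"
    by (rule tendsto_unique[OF sequentially_bot C Lim_transform_eventually[OF tendsto_const]])
       (auto intro!: eventually_mono[OF eventually_ge_at_top[of 1]] simp: order0)
  have "m 0 * \<mu> p q = \<mu> p q"
    by (rule tendsto_unique[OF sequentially_bot tendsto_mult[OF E C] Lim_transform_eventually[OF C]])
       (use eventually_ge_at_top[of 1] in \<open>eventually_elim, simp only: order0\<close>)
  \<comment> \<open>By reflection both halves of the convolution agree, which produces the factor
    \<open>2 * \<alpha>\<close>.\<close>
  have "(\<Sum>s\<le>p. m (p - s) * \<mu> s q) = (\<Sum>s\<le>p. m s * \<mu> (p - s) q)"
    by (rule sum.reindex_bij_witness[of _ "\<lambda>s. p - s" "\<lambda>s. p - s"]) auto
  moreover have "(\<Sum>s\<le>p. m s * \<mu> (p - s) q) = \<mu> p q + (\<Sum>s = 1..p - 1. m s * \<mu> (p - s) q)"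
  proof -
    \<comment> \<open>The endpoint \<open>s = 0\<close> contributes
      \<open>m 0 * \<mu> p q = \<mu> p q\<close>, and \<open>s = p\<close> contributes 0 because
      \<open>\<mu> 0 q = 0\<close>.\<close>
    have "{..p} = insert 0 (insert p {1..p - 1})" using \<open>p \<ge> 1\<close> by auto
    then show ?thesis
      using \<open>p \<ge> 1\<close> \<open>\<mu> 0 q = 0\<close> \<open>m 0 * \<mu> p q = \<mu> p q\<close> by simp
  qed
  moreover have "(\<Sum>s = 1..p. \<mu> s q) = \<mu> p q + (\<Sum>s = 1..p - 1. \<mu> s q)"
    using \<open>p \<ge> 1\<close> by (cases p) auto
  \<comment> \<open>The coefficient of \<open>\<mu> p q\<close> collects
    \<open>p + 1 + \<alpha>1\<close> from the linear term, \<open>\<alpha>2\<close> from the summand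
    \<open>s = p\<close>, and \<open>2 * \<alpha>\<close> from the endpoints of the two
    convolutions.\<close>
  ultimately have "(real p + \<alpha>1 + \<alpha>2 + 2 * \<alpha> + 1) * \<mu> p q =
      real q * (m q - m (p + q)) - \<alpha>2 * (\<Sum>s = 1..p - 1. \<mu> s q)
      - 2 * \<alpha> * (\<Sum>s = 1..p - 1. m s * \<mu> (p - s) q)"
    using limit_eq by (simp add: sum.distrib algebra_simps)
  \<comment> \<open>Adding \<open>\<alpha> > - (1 + \<alpha>1)\<close> and
    \<open>\<alpha> > - (1 + \<alpha>2)\<close> gives
    \<open>2 * \<alpha> + \<alpha>1 + \<alpha>2 + 2 > 0\<close>, and \<open>p + 1 \<ge> 2\<close>;
    so division by the coefficient is legitimate.\<close>
  moreover have "real p + \<alpha>1 + \<alpha>2 + 2 * \<alpha> + 1 > 0"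
  proof -
    have "Min {1, 1 + \<alpha>1, 1 + \<alpha>2} \<le> 1 + \<alpha>1" "Min {1, 1 + \<alpha>1, 1 + \<alpha>2} \<le> 1 + \<alpha>2" by auto
    then show ?thesis using assms(3) \<open>p \<ge> 1\<close> by linarith
  qed
  ultimately show ?thesis by (simp add: field_simps)
qed

end
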